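(* Let $\mathcal{P}\subset\mathbb{R}^p$ be a compact parameter domain, let $\rho$ be a probability distribution on $\mathcal{P}$, and let $\mu_1,\dots,\mu_{n_s}$ be drawn independently from $\rho$. For $\mu\in\mathcal{P}$ let $\bar u(\mu)\in\mathbb{R}^N$ be the (normalized) snapshot, so that $\bar u(\mu)$ is a random vector when $\mu\sim\rho$. Assume there are constants $M,R>0$ such that $\mathbb{E}_{\mu\sim\rho}[\|\bar u(\mu)\|_2^2]\le M^2$ and $\|\bar u(\mu)\|_2^2\le R$ almost surely for $\mu\sim\rho$. Put $$C_p=\mathbb{E}_{\mu\sim\rho}\big[\bar u(\mu)\bar u(\mu)^\top\big],\qquad \hat C_{n_s}=\frac1{n_s}\sum_{i=1}^{n_s}\bar u(\mu_i)\bar u(\mu_i)^\top ,$$ and let $\lambda_1\ge\dots\ge\lambda_N\ge0$ and $\hat\lambda_1\ge\dots\ge\hat\lambda_N\ge0$ be the eigenvalues of $C_p$ and $\hat C_{n_s}$, with corresponding orthonormal eigenvectors $v_k$ and $\hat v_k$. Let $$\delta_k=\min\{\lambda_{k-1}-\lambda_k,\ \lambda_k-\lambda_{k+1}\},\qquad \lambda_0=\infty,\ \lambda_{N+1}=0,$$ and assume $\delta_k>0$ for $k=1,\dots,r_p$, where $1\le r_p\le N$. Let $P=\sum_{k=1}^{r_p}v_kv_k^\top$ and $\hat P=\sum_{k=1}^{r_p}\hat v_k\hat v_k^\top$. Then there is a constant $C$ depending only on $R$ and $\|C_p\|_{\mathrm{op}}$ such that for every $\delta\in(0,1)$ and all sufficiently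 large $n_s$: (i) for each $k=1,\dots,r_p$, with probability at least $1-\delta$, $$\sin\angle(v_k,\hat v_k)\le\frac{2C}{\delta_k}\sqrt{\frac{\log(2N/\delta)}{n_s}};$$ (ii) with probability at least $1-\delta$, $$\|\hat P-P\|_{\mathrm{op}}\le\frac{2\sqrt{r_p}\,C}{\min_{1\le k\le r_p}\delta_k}\sqrt{\frac{\log(2N/\delta)}{n_s}} .$$ Moreover, with $N$ fixed and $n_s\to\infty$, $$\mathbb{E}[\sin\angle(v_k,\hat v_k)]=\mathcal{O}\left(\frac{1}{\delta_k\sqrt{n_s}}\right)\ (1\le k\le r_p),\qquad \mathbb{E}\big[\|\hat P-P\|_{\mathrm{op}}\big]=\mathcal{O}\left(\frac{\sqrt{r_p}}{\min_{1\le k\le r_p}\delta_k\,\sqrt{n_s}}\right).$$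
   Context: For a matrix $A$, $\|A\|_{\mathrm{op}}=\sup_{\|x\|_2=1}\|Ax\|_2$ is the spectral norm. $\angle(v,w)\in[0,\pi/2]$ denotes the angle between the lines spanned by the unit vectors $v,w$, so $\sin\angle(v,w)=\sqrt{1-\langle v,w\rangle^2}$. $N$ is the fixed dimension of the snapshot vectors and $n_s$ is the number of parameter samples. The range of $\hat P$ is the span of the leading $r_p$ left singular vectors of the snapshot matrix $[\bar u(\mu_1),\dots,\bar u(\mu_{n_s})]$. *)

theory Defs
  imports "HOL-Probability.Probability" "Jordan_Normal_Form.Char_Poly"
begin

unbundle no vec_syntax
hide_type (open) Finite_Cartesian_Product.vec
hide_const (open) Finite_Cartesian_Product.vec

text \<open>
  The constants in the theorem must not depend on the dimensions, so dimensions are numbers rather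
  than types. Snapshots and matrices use the carriers of \<^theory>\<open>Jordan_Normal_Form.Matrix\<close>. The
  parameter space, on which only topology and Borel sets matter, is a subspace of the product
  space \<^typ>\<open>nat \<Rightarrow> real\<close>; the topology and Borel sets this induces on \<open>real_space p\<close> are those of
  Euclidean $p$-space.
\<close>

definition real_space :: "nat \<Rightarrow> (nat \<Rightarrow> real) set" where
  "real_space p = {x. \<forall>i\<ge>p. x i = 0}"

definition norm2 :: "real vec \<Rightarrow> real" where
  "norm2 x = sqrt (x \<bullet> x)"

definition spectral_norm :: "real mat \<Rightarrow> real" where
  "spectral_norm A = (SUP x\<in>{x \<in> carrier_vec (dim_col A). norm2 x = 1}. norm2 (A *\<^sub>v x))"

definition line_angle :: "real vec \<Rightarrow> real vec \<Rightarrow> real" where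
  "line_angle v w = arccos \<bar>v \<bullet> w\<bar>"

definition second_moment :: "nat \<Rightarrow> 'a measure \<Rightarrow> ('a \<Rightarrow> real vec) \<Rightarrow> real mat" where
  "second_moment N \<rho> u = mat N N (\<lambda>(i, j). \<integral>\<mu>. u \<mu> $ i * u \<mu> $ j \<partial>\<rho>)"

definition sample_moment :: "nat \<Rightarrow> ('a \<Rightarrow> real vec) \<Rightarrow> nat \<Rightarrow> (nat \<Rightarrow> 'a) \<Rightarrow> real mat" where
  "sample_moment N u n \<omega> = mat N N (\<lambda>(i, j). (\<Sum>s=1..n. u (\<omega> s) $ i * u (\<omega> s) $ j) / real n)"

text \<open>The joint law of \<open>n\<close> independent draws from \<open>\<rho>\<close>.\<close>

definition iid :: "nat \<Rightarrow> 'a measure \<Rightarrow> (nat \<Rightarrow> 'a) measure" where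
  "iid n \<rho> = (\<Pi>\<^sub>M s\<in>{1..n}. \<rho>)"

text \<open>
  Eigenvalues and eigenvectors are indexed by \<open>1, \<dots>, N\<close>; the \<open>N\<close> orthonormal eigenvectors
  ensure that all eigenvalues are listed with multiplicity.
\<close>

definition ordered_eigensystem ::
    "nat \<Rightarrow> real mat \<Rightarrow> (nat \<Rightarrow> real) \<Rightarrow> (nat \<Rightarrow> real vec) \<Rightarrow> bool" where
  "ordered_eigensystem N A l v \<longleftrightarrow>
     (\<forall>k\<in>{1..N}. eigenvector A (v k) (l k)) \<and>
     (\<forall>j\<in>{1..N}. \<forall>k\<in>{1..N}. v j \<bullet> v k = (if j = k then 1 else 0)) \<and>
     (\<forall>j\<in>{1..N}. \<forall>k\<in>{1..N}. j \<le> k \<longrightarrow> l k \<le> l j) \<and>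
     (\<forall>k\<in>{1..N}. 0 \<le> l k)"

definition padded_eigenvalue :: "nat \<Rightarrow> (nat \<Rightarrow> real) \<Rightarrow> nat \<Rightarrow> ereal" where
  "padded_eigenvalue N l k = (if k = 0 then \<infinity> else if k \<le> N then ereal (l k) else 0)"

text \<open>For \<open>k\<close> in \<open>1, \<dots>, N\<close> the minimum is finite, so \<^const>\<open>real_of_ereal\<close> loses nothing.\<close>

definition eigengap :: "nat \<Rightarrow> (nat \<Rightarrow> real) \<Rightarrow> nat \<Rightarrow> real" where
  "eigengap N l k = real_of_ereal
     (min (padded_eigenvalue N l (k - 1) - padded_eigenvalue N l k)
          (padded_eigenvalue N l k - padded_eigenvalue N l (k + 1)))"

definition span_projection :: "nat \<Rightarrow> nat \<Rightarrow> (nat \<Rightarrow> real vec) \<Rightarrow> real mat" where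
  "span_projection N r v = mat N N (\<lambda>(i, j). \<Sum>k=1..r. v k $ i * v k $ j)"

end

theory Submission
  imports Defs
begin

text \<open>
  Write \<open>E\<close> for the difference of the sample second moment and the second moment \<open>C\<^sub>p\<close>. Both bounds
  split into a deterministic perturbation estimate, which is linear in the Frobenius norm of \<open>E\<close>, and
  a concentration estimate for that norm. The Frobenius norm is a Hilbert space norm, so the
  concentration is free of the dimension, and one can take \<open>C = 4 R\<close>; every sample size
  \<open>n \<ge> 1\<close> is large enough.

  Concentration. \<open>n E\<close> is a sum of independent centred random elements of the Euclidean space of
  matrices, each of norm at most \<open>2 R\<close>, because an outer product \<open>u u\<^sup>T\<close> has Frobenius norm
  \<open>|u|\<^sup>2\<close>. The function \<open>s \<mapsto> cosh (sqrt s)\<close> is convex, being a power series with nonnegative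
  coefficients, and \<open>|x + y|\<^sup>2\<close> is affine in \<open>\<langle>x, y\<rangle>\<close> for fixed norms. Bounding \<open>cosh |x + y|\<close> by
  the chord over the possible values of \<open>\<langle>x, y\<rangle>\<close> and averaging over a centred \<open>y\<close> with
  \<open>|y| \<le> b\<close> kills the linear term and leaves \<open>cosh |x| cosh b\<close> (\<open>cosh_L2_set_add_le\<close>). Induction
  on \<open>n\<close> gives a Gaussian bound for the expectation of \<open>cosh\<close> of the norm of the sum, hence both a
  tail bound and a bound on the mean (\<open>sample_mean_deviation\<close>).

  Perturbation. Norms and scalar products of matrices are those of Frobenius. Let \<open>P\<close> and \<open>Q\<close> be the projections onto the leading \<open>r\<close> eigenvectors of \<open>A\<close> and
  \<open>B\<close>, where \<open>g\<close> is the gap below the \<open>r\<close>-th eigenvalue of \<open>A\<close>. The quantitative Ky Fan principle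
  \<open>g |P - Q|\<^sup>2 \<le> 2 \<langle>A, P - Q\<rangle>\<close> (\<open>gap_projection_le\<close>), together with the same principle for \<open>B\<close>,
  which says that \<open>\<langle>B, P - Q\<rangle> \<le> 0\<close>, yields \<open>g |P - Q|\<^sup>2 \<le> 2 \<langle>A - B, P - Q\<rangle>\<close>, and
  Cauchy-Schwarz gives \<open>g |P - Q| \<le> 2 |A - B|\<close> (\<open>davis_kahan_leading\<close>). This is the
  bound on the projections. For a single eigenvector, \<open>v\<^sub>k v\<^sub>k\<^sup>T\<close> is a difference of two
  leading projections, whose gaps are both at least \<open>\<delta>\<^sub>k\<close>, and the distance of two rank-one projections
  is the square root of 2 times the sine of the angle between their lines.
\<close>

section \<open>Inner products over finite index sets\<close>

definition dot :: "'i set \<Rightarrow> ('i \<Rightarrow> real) \<Rightarrow> ('i \<Rightarrow> real) \<Rightarrow> real" where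
  "dot I x y = (\<Sum>i\<in>I. x i * y i)"

lemma L2_set_power2: "(L2_set x I)\<^sup>2 = dot I x x"
  unfolding L2_set_def dot_def by (simp add: sum_nonneg power2_eq_square flip: real_sqrt_mult)

lemma dot_commute: "dot I x y = dot I y x"
  by (simp add: dot_def mult.commute)

lemma dot_diff_left: "dot I (\<lambda>i. x i - y i) z = dot I x z - dot I y z"
  by (simp add: dot_def left_diff_distrib sum_subtractf)

lemma dot_diff_right: "dot I z (\<lambda>i. x i - y i) = dot I z x - dot I z y"
  by (simp add: dot_def right_diff_distrib sum_subtractf)

lemma abs_dot_le: "\<bar>dot I x y\<bar> \<le> L2_set x I * L2_set y I"
proof -
  have "\<bar>dot I x y\<bar> \<le> (\<Sum>i\<in>I. \<bar>x i\<bar> * \<bar>y i\<bar>)"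
    unfolding dot_def by (rule order_trans[OF sum_abs]) (simp add: abs_mult)
  then show ?thesis using L2_set_mult_ineq order_trans by blast
qed

lemma L2_set_diff_power2:
  "(L2_set (\<lambda>i. x i - y i) I)\<^sup>2 = dot I x x - 2 * dot I x y + dot I y y"
  by (simp add: L2_set_power2 dot_diff_left dot_diff_right dot_commute[of I y x])

lemma L2_set_add_power2:
  "(L2_set (\<lambda>i. x i + y i) I)\<^sup>2 = (L2_set x I)\<^sup>2 + 2 * dot I x y + (L2_set y I)\<^sup>2"
  unfolding L2_set_power2 by (simp add: dot_def algebra_simps sum.distrib sum_distrib_left)

lemma L2_set_minus: "L2_set (\<lambda>i. - x i) I = L2_set x I"
  by (simp add: L2_set_def)

lemma L2_set_diff_le: "L2_set (\<lambda>i. x i - y i) I \<le> L2_set x I + L2_set y I"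
  using L2_set_triangle_ineq[of x "\<lambda>i. - y i" I] by (simp add: L2_set_minus)

section \<open>Concentration\<close>

lemma cosh_sqrt_sums:
  fixes s :: real
  assumes "0 \<le> s"
  shows "(\<lambda>n. if even n then s ^ (n div 2) / fact n else 0) sums cosh (sqrt s)"
proof -
  have "sqrt s ^ (2 * m) = s ^ m" for m
    using assms by (simp add: power_mult)
  then have "(if even n then sqrt s ^ n /\<^sub>R fact n else 0) = (if even n then s ^ (n div 2) / fact n else 0)" for n
    by (auto elim!: evenE simp: divide_inverse mult.commute)
  then show ?thesis
    using cosh_converges[of "sqrt s"] by presburger
qed

text \<open>
  Each term \<open>s ^ m / fact (2 * m)\<close> of the power series is convex on the nonnegative reals.
\<close>
lemma convex_on_cosh_sqrt: "convex_on {0..} (\<lambda>s::real. cosh (sqrt s))"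
proof (rule convex_onI)
  fix t x y :: real
  assume t: "0 < t" "t < 1" and xy: "x \<in> {0..}" "y \<in> {0..}"
  let ?f = "\<lambda>s n. if even n then s ^ (n div 2) / fact n else (0::real)"
  have nn: "0 \<le> (1 - t) * x + t * y" using t xy by simp
  have pow: "((1 - t) * x + t * y) ^ m \<le> (1 - t) * x ^ m + t * y ^ m" for m
  proof -
    have "convex_on {0::real..} (\<lambda>x. x ^ m)"
    proof (cases "even m")
      case True
      show ?thesis by (rule convex_on_subset[OF convex_power_even[OF True]]) auto
    qed (rule convex_power_odd)
    from convex_onD[OF this, of t x y] t xy show ?thesis by simp
  qed
  have "(\<lambda>n. (1 - t) * ?f x n + t * ?f y n) sums ((1 - t) * cosh (sqrt x) + t * cosh (sqrt y))"
    using xy by (intro sums_add sums_mult cosh_sqrt_sums) auto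
  from sums_le[OF _ cosh_sqrt_sums[OF nn] this]
  show "cosh (sqrt ((1 - t) *\<^sub>R x + t *\<^sub>R y)) \<le> (1 - t) * cosh (sqrt x) + t * cosh (sqrt y)"
    using pow by (auto simp: divide_right_mono simp flip: add_divide_distrib)
qed simp

text \<open>
  The argument of the square root is at most the convex combination of \<open>(a - b)\<^sup>2\<close> and \<open>(a + b)\<^sup>2\<close>
  with weight \<open>(1 + c / (a * b)) / 2\<close> on the latter, and at these two points \<open>cosh (sqrt s)\<close> is
  \<open>cosh (a - b)\<close> and \<open>cosh (a + b)\<close>.
\<close>
lemma cosh_sqrt_chord:
  fixes a b c q :: real
  assumes ab: "0 < a" "0 < b" and c: "\<bar>c\<bar> \<le> a * b" and q: "q \<le> b\<^sup>2" and nn: "0 \<le> a\<^sup>2 + 2 * c + q"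
  shows "cosh (sqrt (a\<^sup>2 + 2 * c + q)) \<le> cosh a * cosh b + c * (sinh a * sinh b / (a * b))"
proof -
  define t where "t = (1 + c / (a * b)) / 2"
  have ab0: "0 < a * b" using ab by simp
  have "\<bar>c / (a * b)\<bar> \<le> 1" using c ab0 by (simp add: abs_divide)
  then have t: "0 \<le> t" "t \<le> 1" unfolding t_def abs_le_iff by simp_all
  have c_t: "c = (2 * t - 1) * (a * b)" using ab by (simp add: t_def field_simps)
  have "cosh (sqrt (a\<^sup>2 + 2 * c + q)) \<le> cosh (sqrt ((1 - t) * (a - b)\<^sup>2 + t * (a + b)\<^sup>2))"
  proof (subst cosh_real_nonneg_le_iff)
    have "a\<^sup>2 + 2 * c + q \<le> (1 - t) * (a - b)\<^sup>2 + t * (a + b)\<^sup>2"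
      using q unfolding c_t by (simp add: power2_eq_square algebra_simps)
    then show "sqrt (a\<^sup>2 + 2 * c + q) \<le> sqrt ((1 - t) * (a - b)\<^sup>2 + t * (a + b)\<^sup>2)" by simp
  qed (use nn t in auto)
  also have "\<dots> \<le> (1 - t) * cosh (sqrt ((a - b)\<^sup>2)) + t * cosh (sqrt ((a + b)\<^sup>2))"
    using convex_onD[OF convex_on_cosh_sqrt t, of "(a - b)\<^sup>2" "(a + b)\<^sup>2"] by simp
  also have "\<dots> = cosh a * cosh b + (2 * t - 1) * (sinh a * sinh b)"
    by (simp add: cosh_add cosh_diff algebra_simps)
  finally show ?thesis using ab by (simp add: c_t)
qed

text \<open>
  The second summand is linear in \<open>y\<close>, so it disappears when \<open>y\<close> is random and centred. For \<open>x = 0\<close>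
  the quotient is a division by zero, harmless because the inner product vanishes too.
\<close>
lemma cosh_L2_set_add_le:
  assumes b: "0 < b" and y: "L2_set y I \<le> b"
  shows "cosh (L2_set (\<lambda>i. x i + y i) I) \<le> cosh (L2_set x I) * cosh b
           + dot I x y * (sinh (L2_set x I) * sinh b / (L2_set x I * b))"
proof (cases "L2_set x I = 0")
  case True
  then have d: "dot I x y = 0" using abs_dot_le[of I x y] by simp
  have "(L2_set (\<lambda>i. x i + y i) I)\<^sup>2 = (L2_set y I)\<^sup>2"
    unfolding L2_set_add_power2 by (simp add: d True)
  then have "L2_set (\<lambda>i. x i + y i) I = L2_set y I" by simp
  then show ?thesis using True y b by (simp add: cosh_real_nonneg_le_iff)
next
  case False
  let ?a = "L2_set x I"
  have a: "0 < ?a" using False L2_set_nonneg[of x I] by linarith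
  have e: "?a\<^sup>2 + 2 * dot I x y + (L2_set y I)\<^sup>2 = (L2_set (\<lambda>i. x i + y i) I)\<^sup>2"
    by (simp add: L2_set_add_power2)
  have "\<bar>dot I x y\<bar> \<le> ?a * b"
    using abs_dot_le[of I x y] y a by (meson mult_left_mono less_imp_le order_trans)
  moreover have "(L2_set y I)\<^sup>2 \<le> b\<^sup>2" using y by (simp add: power_mono)
  moreover have "0 \<le> ?a\<^sup>2 + 2 * dot I x y + (L2_set y I)\<^sup>2" unfolding e by simp
  ultimately have "cosh (sqrt (?a\<^sup>2 + 2 * dot I x y + (L2_set y I)\<^sup>2))
      \<le> cosh ?a * cosh b + dot I x y * (sinh ?a * sinh b / (?a * b))"
    by (rule cosh_sqrt_chord[OF a b])
  then show ?thesis unfolding e by simp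
qed

text \<open>
  Hoeffding's lemma for a fair sign, whose moment generating function is \<open>cosh\<close>.
\<close>
lemma cosh_le_exp_square: "cosh b \<le> exp (b\<^sup>2 / 2)" if "0 \<le> b" for b :: real
proof -
  \<comment> \<open>A Bernoulli variable of parameter \<open>1 / 2\<close> at argument \<open>2 * b\<close> is a fair sign at argument \<open>b\<close>, up to a shift.\<close>
  have e: "1 + (exp (2 * b) - 1) / 2 = exp b * cosh b"
    by (simp add: cosh_field_def exp_double field_simps power2_eq_square flip: exp_add)
  have "- (2 * b) * (1 / 2) + ln (1 + 1 / 2 * (exp (2 * b) - 1)) \<le> (2 * b)\<^sup>2 / 8"
    using Hoeffdings_lemma_aux[of "2 * b" "1 / 2"] that by simp
  then have "ln (cosh b) \<le> b\<^sup>2 / 2"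
    using e by (simp add: ln_mult power2_eq_square)
  then show ?thesis by (metis cosh_real_pos exp_le_cancel_iff exp_ln)
qed

lemma nn_integral_cosh_L2_set_add_le:
  fixes X :: "'i \<Rightarrow> 'a \<Rightarrow> real"
  assumes "prob_space M"
    and int: "\<And>i. i \<in> I \<Longrightarrow> integrable M (X i)"
    and mean: "\<And>i. i \<in> I \<Longrightarrow> (\<integral>\<mu>. X i \<mu> \<partial>M) = 0"
    and b: "0 < b" and bound: "AE \<mu> in M. L2_set (\<lambda>i. X i \<mu>) I \<le> b"
  shows "(\<integral>\<^sup>+\<mu>. ennreal (cosh (L2_set (\<lambda>i. x i + X i \<mu>) I)) \<partial>M) \<le> ennreal (cosh (L2_set x I) * cosh b)"
proof -
  interpret prob_space M by fact
  define \<kappa> where "\<kappa> = sinh (L2_set x I) * sinh b / (L2_set x I * b)"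
  let ?g = "\<lambda>\<mu>. cosh (L2_set x I) * cosh b + dot I x (\<lambda>i. X i \<mu>) * \<kappa>"
  have le: "AE \<mu> in M. cosh (L2_set (\<lambda>i. x i + X i \<mu>) I) \<le> ?g \<mu>"
    using bound by eventually_elim (use cosh_L2_set_add_le[OF b] in \<open>simp add: \<kappa>_def\<close>)
  have int_dot: "integrable M (\<lambda>\<mu>. dot I x (\<lambda>i. X i \<mu>))"
    unfolding dot_def by (intro Bochner_Integration.integrable_sum integrable_mult_right int)
  have dot0: "(\<integral>\<mu>. dot I x (\<lambda>i. X i \<mu>) \<partial>M) = 0"
    unfolding dot_def using int mean by (subst Bochner_Integration.integral_sum) auto
  have "(\<integral>\<^sup>+\<mu>. ennreal (cosh (L2_set (\<lambda>i. x i + X i \<mu>) I)) \<partial>M) \<le> (\<integral>\<^sup>+\<mu>. ennreal (?g \<mu>) \<partial>M)"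
    using le by (intro nn_integral_mono_AE) (auto elim: eventually_mono intro: ennreal_leI)
  also have "\<dots> = ennreal (\<integral>\<mu>. ?g \<mu> \<partial>M)"
  proof (rule nn_integral_eq_integral)
    show "integrable M ?g" using int_dot by auto
    show "AE \<mu> in M. 0 \<le> ?g \<mu>"
      using le by eventually_elim (meson cosh_real_nonneg order_trans)
  qed
  also have "(\<integral>\<mu>. ?g \<mu> \<partial>M) = cosh (L2_set x I) * cosh b"
    using int_dot dot0 by (simp add: prob_space)
  finally show ?thesis .
qed

text \<open>
  Induction over the sample: integrating out one draw, with the others fixed, costs a factor \<open>cosh b\<close>.
\<close>
lemma nn_integral_cosh_sum_le:
  fixes X :: "'i \<Rightarrow> 'a \<Rightarrow> real"
  assumes M: "prob_space M"
    and int: "\<And>i. i \<in> I \<Longrightarrow> integrable M (X i)"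
    and mean: "\<And>i. i \<in> I \<Longrightarrow> (\<integral>\<mu>. X i \<mu> \<partial>M) = 0"
    and b: "0 < b" and bound: "AE \<mu> in M. L2_set (\<lambda>i. X i \<mu>) I \<le> b"
    and "finite (J :: 'j set)"
  shows "(\<integral>\<^sup>+\<omega>. ennreal (cosh (L2_set (\<lambda>i. \<Sum>s\<in>J. X i (\<omega> s)) I)) \<partial>(\<Pi>\<^sub>M s\<in>J. M))
           \<le> ennreal (cosh b ^ card J)"
  using \<open>finite J\<close>
proof (induction J)
  case empty
  show ?case by (simp add: space_PiM L2_set_0')
next
  case (insert s J)
  interpret prob_space M by (rule M)
  interpret product_sigma_finite "\<lambda>_ :: 'j. M"
    by (intro product_sigma_finite.intro) (rule sigma_finite_measure_axioms)
  have meas: "X i \<in> borel_measurable M" if "i \<in> I" for i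
    using int[OF that] by simp
  have measF[measurable]: "(\<lambda>\<omega>. ennreal (cosh (L2_set (\<lambda>i. \<Sum>s\<in>K. X i (\<omega> s)) I)))
      \<in> borel_measurable (\<Pi>\<^sub>M s\<in>K. M)" for K
    unfolding L2_set_def cosh_field_def
    using meas by (auto intro!: borel_measurable_divide borel_measurable_add borel_measurable_exp borel_measurable_uminus borel_measurable_sqrt borel_measurable_sum
      borel_measurable_power measurable_compose[OF measurable_component_singleton] measurable_compose[OF _ measurable_ennreal] simp: cosh_field_def)
  have "(\<integral>\<^sup>+\<omega>. ennreal (cosh (L2_set (\<lambda>i. \<Sum>s\<in>insert s J. X i (\<omega> s)) I)) \<partial>(\<Pi>\<^sub>M s\<in>insert s J. M))
      = (\<integral>\<^sup>+\<omega>. (\<integral>\<^sup>+\<mu>. ennreal (cosh (L2_set (\<lambda>i. \<Sum>t\<in>insert s J. X i ((fun_upd \<omega> s \<mu>) t)) I)) \<partial>M)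
           \<partial>(\<Pi>\<^sub>M s\<in>J. M))"
    by (rule product_nn_integral_insert[OF insert.hyps measF[of "insert s J"]])
  also have "\<dots> = (\<integral>\<^sup>+\<omega>. (\<integral>\<^sup>+\<mu>. ennreal (cosh (L2_set (\<lambda>i. (\<Sum>t\<in>J. X i (\<omega> t)) + X i \<mu>) I)) \<partial>M)
           \<partial>(\<Pi>\<^sub>M s\<in>J. M))"
  proof -
    have "(\<Sum>t\<in>J. X i ((fun_upd \<omega> s \<mu>) t)) = (\<Sum>t\<in>J. X i (\<omega> t))" for i \<omega> \<mu>
      using insert by (intro sum.cong) auto
    then have "(\<Sum>t\<in>insert s J. X i ((fun_upd \<omega> s \<mu>) t)) = (\<Sum>t\<in>J. X i (\<omega> t)) + X i \<mu>" for i \<omega> \<mu>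
      using insert.hyps by simp
    then show ?thesis by simp
  qed
  also have "\<dots> \<le> (\<integral>\<^sup>+\<omega>. ennreal (cosh (L2_set (\<lambda>i. \<Sum>t\<in>J. X i (\<omega> t)) I) * cosh b) \<partial>(\<Pi>\<^sub>M s\<in>J. M))"
    by (intro nn_integral_mono nn_integral_cosh_L2_set_add_le M int mean b bound)
  also have "\<dots> = (\<integral>\<^sup>+\<omega>. ennreal (cosh (L2_set (\<lambda>i. \<Sum>t\<in>J. X i (\<omega> t)) I)) \<partial>(\<Pi>\<^sub>M s\<in>J. M)) * ennreal (cosh b)"
    unfolding ennreal_mult[OF cosh_real_nonneg cosh_real_nonneg] by (rule nn_integral_multc[OF measF])
  also have "\<dots> \<le> ennreal (cosh b ^ card J) * ennreal (cosh b)"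
    by (intro mult_right_mono insert.IH) simp
  also have "\<dots> = ennreal (cosh b ^ card (insert s J))"
    using insert by (simp add: mult.commute flip: ennreal_mult)
  finally show ?case .
qed

lemma cosh_sum_iid:
  fixes Y :: "'i \<Rightarrow> 'a \<Rightarrow> real" and n :: nat
  assumes M: "prob_space M"
    and int: "\<And>i. i \<in> I \<Longrightarrow> integrable M (Y i)"
    and mean: "\<And>i. i \<in> I \<Longrightarrow> (\<integral>\<mu>. Y i \<mu> \<partial>M) = 0"
    and b: "0 < b" and bound: "AE \<mu> in M. L2_set (\<lambda>i. Y i \<mu>) I \<le> b"
    and c: "0 < c"
  defines "S \<equiv> \<lambda>\<omega>. L2_set (\<lambda>i. \<Sum>s=1..n. Y i (\<omega> s)) I"
  shows borel_measurable_sum_iid: "S \<in> borel_measurable (iid n M)"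
    and integrable_cosh_sum_iid: "integrable (iid n M) (\<lambda>\<omega>. cosh (c * S \<omega>))"
    and integral_cosh_sum_iid: "(\<integral>\<omega>. cosh (c * S \<omega>) \<partial>iid n M) \<le> exp (real n * (c * b)\<^sup>2 / 2)"
proof -
  interpret prob_space M by (rule M)
  have meas: "Y i \<in> borel_measurable M" if "i \<in> I" for i
    using int[OF that] by simp
  show S: "S \<in> borel_measurable (iid n M)"
    unfolding S_def L2_set_def iid_def
    by (intro measurable_compose[OF _ borel_measurable_sqrt] borel_measurable_sum
        borel_measurable_power measurable_compose[OF measurable_component_singleton] meas)
  have cS: "L2_set (\<lambda>i. \<Sum>s=1..n. c * Y i (\<omega> s)) I = c * S \<omega>" for \<omega>
    unfolding S_def using c by (simp add: L2_set_right_distrib sum_distrib_left)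
  have "(\<integral>\<^sup>+\<omega>. ennreal (cosh (c * S \<omega>)) \<partial>iid n M) \<le> ennreal (cosh (c * b) ^ card {1..n})"
    unfolding iid_def cS[symmetric]
  proof (rule nn_integral_cosh_sum_le[OF M])
    show "AE \<mu> in M. L2_set (\<lambda>i. c * Y i \<mu>) I \<le> c * b"
      using bound c by (auto simp flip: L2_set_right_distrib)
  qed (use int mean b c in auto)
  also have "\<dots> \<le> ennreal (exp ((c * b)\<^sup>2 / 2) ^ n)"
    using b c by (auto intro!: ennreal_leI power_mono cosh_le_exp_square)
  also have "exp ((c * b)\<^sup>2 / 2) ^ n = exp (real n * (c * b)\<^sup>2 / 2)"
    by (simp flip: exp_of_nat_mult)
  finally have le: "(\<integral>\<^sup>+\<omega>. ennreal (cosh (c * S \<omega>)) \<partial>iid n M) \<le> ennreal (exp (real n * (c * b)\<^sup>2 / 2))" .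
  have [measurable]: "(\<lambda>\<omega>. cosh (c * S \<omega>)) \<in> borel_measurable (iid n M)"
    unfolding cosh_field_def using S by measurable
  show i: "integrable (iid n M) (\<lambda>\<omega>. cosh (c * S \<omega>))"
    by (rule integrableI_bounded) (use le in \<open>auto intro: le_less_trans\<close>)
  show "(\<integral>\<omega>. cosh (c * S \<omega>) \<partial>iid n M) \<le> exp (real n * (c * b)\<^sup>2 / 2)"
    using le by (subst (asm) nn_integral_eq_integral[OF i]) auto
qed

lemma prob_space_iid: "prob_space M \<Longrightarrow> prob_space (iid n M)"
  unfolding iid_def by (rule prob_space_PiM)

text \<open>
  Chernoff's method with \<open>cosh\<close> in place of \<open>exp\<close>; the factor 2 comes from \<open>exp x \<le> 2 * cosh x\<close>.
\<close>
lemma tail_sum_iid: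
  fixes Y :: "'i \<Rightarrow> 'a \<Rightarrow> real" and n :: nat
  assumes M: "prob_space M"
    and int: "\<And>i. i \<in> I \<Longrightarrow> integrable M (Y i)"
    and mean: "\<And>i. i \<in> I \<Longrightarrow> (\<integral>\<mu>. Y i \<mu> \<partial>M) = 0"
    and b: "0 < b" and bound: "AE \<mu> in M. L2_set (\<lambda>i. Y i \<mu>) I \<le> b"
    and n: "1 \<le> n" and t: "0 < t"
  shows "\<P>(\<omega> in iid n M. t \<le> L2_set (\<lambda>i. \<Sum>s=1..n. Y i (\<omega> s)) I) \<le> 2 * exp (- (t\<^sup>2 / (2 * real n * b\<^sup>2)))"
proof -
  define S where "S \<omega> = L2_set (\<lambda>i. \<Sum>s=1..n. Y i (\<omega> s)) I" for \<omega>
  \<comment> \<open>The minimiser of \<open>n * (c * b)\<^sup>2 / 2 - c * t\<close>.\<close>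
  define c where "c = t / (real n * b\<^sup>2)"
  have c: "0 < c" using t n b by (simp add: c_def)
  note S = cosh_sum_iid[OF M int mean b bound c, of n, folded S_def]
  interpret prob_space "iid n M" by (rule prob_space_iid[OF M])
  have [measurable]: "S \<in> borel_measurable (iid n M)" by (rule S(1))
  have "\<P>(\<omega> in iid n M. t \<le> S \<omega>) \<le> \<P>(\<omega> in iid n M. exp (c * t) / 2 \<le> cosh (c * S \<omega>))"
  proof (rule finite_measure_mono)
    have "exp (c * t) / 2 \<le> cosh (c * S \<omega>)" if "t \<le> S \<omega>" for \<omega>
    proof -
      have "exp (c * t) \<le> exp (c * S \<omega>) + exp (- (c * S \<omega>))"
        using that c by (intro add_increasing2) auto
      then show ?thesis by (simp add: cosh_field_def)
    qed
    then show "{\<omega> \<in> space (iid n M). t \<le> S \<omega>} \<subseteq> {\<omega> \<in> space (iid n M). exp (c * t) / 2 \<le> cosh (c * S \<omega>)}"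
      by auto
  qed (unfold cosh_field_def, measurable)
  also have "\<dots> \<le> (\<integral>\<omega>. cosh (c * S \<omega>) \<partial>iid n M) / (exp (c * t) / 2)"
    using S(2) by (intro integral_Markov_inequality_measure[where A = "{}"]) auto
  also have "\<dots> \<le> exp (real n * (c * b)\<^sup>2 / 2) / (exp (c * t) / 2)"
    by (intro divide_right_mono S(3)) auto
  also have "\<dots> = 2 * exp (real n * (c * b)\<^sup>2 / 2 - c * t)"
    by (simp add: exp_diff)
  also have "real n * (c * b)\<^sup>2 / 2 - c * t = - (t\<^sup>2 / (2 * real n * b\<^sup>2))"
    using n b by (simp add: c_def power2_eq_square field_simps)
  finally show ?thesis unfolding S_def .
qed

text \<open>
  The bound on \<open>cosh\<close> of the sum already controls the mean, since \<open>x \<le> cosh x\<close>.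
\<close>
lemma expectation_sum_iid:
  fixes Y :: "'i \<Rightarrow> 'a \<Rightarrow> real" and n :: nat
  assumes M: "prob_space M"
    and int: "\<And>i. i \<in> I \<Longrightarrow> integrable M (Y i)"
    and mean: "\<And>i. i \<in> I \<Longrightarrow> (\<integral>\<mu>. Y i \<mu> \<partial>M) = 0"
    and b: "0 < b" and bound: "AE \<mu> in M. L2_set (\<lambda>i. Y i \<mu>) I \<le> b"
    and n: "1 \<le> n"
  defines "S \<equiv> \<lambda>\<omega>. L2_set (\<lambda>i. \<Sum>s=1..n. Y i (\<omega> s)) I"
  shows "integrable (iid n M) S" and "(\<integral>\<omega>. S \<omega> \<partial>iid n M) \<le> 2 * b * sqrt (real n)"
proof -
  \<comment> \<open>This scale makes the Gaussian bound \<open>exp (1 / 2)\<close>, whatever \<open>n\<close> is.\<close>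
  define c where "c = 1 / (b * sqrt (real n))"
  have c: "0 < c" using n b by (simp add: c_def)
  have S_apply: "S \<omega> = L2_set (\<lambda>i. \<Sum>s=1..n. Y i (\<omega> s)) I" for \<omega>
    by (simp only: S_def)
  note S = cosh_sum_iid[OF M int mean b bound c, of n, folded S_apply]
  have le_cosh: "x \<le> cosh x" if "0 \<le> x" for x :: real
  proof -
    have "0 \<le> (x - 1)\<^sup>2 + 1" by simp
    then have "2 * x \<le> 1 + x + x\<^sup>2 / 2" by (simp add: power2_eq_square algebra_simps)
    also have "\<dots> \<le> exp x" using that by (rule exp_lower_Taylor_quadratic)
    also have "\<dots> \<le> exp x + exp (- x)" by simp
    finally show ?thesis by (simp add: cosh_field_def)
  qed
  have S0: "0 \<le> S \<omega>" for \<omega> by (simp add: S_def)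
  have cS: "c * S \<omega> \<le> cosh (c * S \<omega>)" for \<omega> using c S0 by (intro le_cosh) simp
  have i: "integrable (iid n M) (\<lambda>\<omega>. c * S \<omega>)"
    by (rule Bochner_Integration.integrable_bound[OF S(2)]) (use S(1) cS c S0 in auto)
  then show iS: "integrable (iid n M) S" using c by simp
  have "c * (\<integral>\<omega>. S \<omega> \<partial>iid n M) = (\<integral>\<omega>. c * S \<omega> \<partial>iid n M)" by simp
  also have "\<dots> \<le> (\<integral>\<omega>. cosh (c * S \<omega>) \<partial>iid n M)"
    by (intro integral_mono i S(2) cS)
  also have "\<dots> \<le> exp (real n * (c * b)\<^sup>2 / 2)" by (rule S(3))
  also have "real n * (c * b)\<^sup>2 / 2 = 1 / 2"
    using n b by (simp add: c_def power_divide power_mult_distrib)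
  also have "exp (1 / 2 :: real) \<le> 2" by (rule exp_half_le2)
  finally show "(\<integral>\<omega>. S \<omega> \<partial>iid n M) \<le> 2 * b * sqrt (real n)"
    using n b by (simp add: c_def field_simps)
qed

text \<open>
  Jensen's inequality for the norm, obtained by pairing the mean with itself.
\<close>
lemma L2_set_mean_le:
  fixes Z :: "'i \<Rightarrow> 'a \<Rightarrow> real"
  assumes M: "prob_space M"
    and int: "\<And>i. i \<in> I \<Longrightarrow> integrable M (Z i)"
    and bound: "AE \<mu> in M. L2_set (\<lambda>i. Z i \<mu>) I \<le> b" and b: "0 \<le> b"
  shows "L2_set (\<lambda>i. \<integral>\<mu>. Z i \<mu> \<partial>M) I \<le> b"
proof -
  interpret prob_space M by (rule M)
  define m where "m = (\<lambda>i. \<integral>\<mu>. Z i \<mu> \<partial>M)"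
  have "(L2_set m I)\<^sup>2 = (\<Sum>i\<in>I. m i * (\<integral>\<mu>. Z i \<mu> \<partial>M))"
    by (simp add: L2_set_power2 dot_def m_def)
  also have "\<dots> = (\<integral>\<mu>. dot I m (\<lambda>i. Z i \<mu>) \<partial>M)"
    unfolding dot_def using int by (subst Bochner_Integration.integral_sum) auto
  also have "\<dots> \<le> (\<integral>\<mu>. L2_set m I * b \<partial>M)"
  proof (rule integral_mono_AE)
    show "integrable M (\<lambda>\<mu>. dot I m (\<lambda>i. Z i \<mu>))"
      unfolding dot_def by (intro Bochner_Integration.integrable_sum integrable_mult_right int)
    have "dot I m (\<lambda>i. Z i \<mu>) \<le> L2_set m I * b" if "L2_set (\<lambda>i. Z i \<mu>) I \<le> b" for \<mu>
      using abs_dot_le[of I m "\<lambda>i. Z i \<mu>"] mult_left_mono[OF that L2_set_nonneg[of m I]] by linarith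
    then show "AE \<mu> in M. dot I m (\<lambda>i. Z i \<mu>) \<le> L2_set m I * b"
      using bound by auto
  qed simp
  also have "\<dots> = L2_set m I * b" by (simp add: prob_space)
  finally have "L2_set m I * L2_set m I \<le> L2_set m I * b" by (simp add: power2_eq_square)
  then show ?thesis
    using b L2_set_nonneg[of m I] unfolding m_def[symmetric] by (cases "L2_set m I = 0") auto
qed

text \<open>
  Centring at most doubles the bound on a single draw, which is the origin of the factor 2 in front
  of \<open>R\<close>.
\<close>
lemma sample_mean_deviation:
  fixes Z :: "'i \<Rightarrow> 'a \<Rightarrow> real" and n :: nat
  assumes M: "prob_space M"
    and int: "\<And>i. i \<in> I \<Longrightarrow> integrable M (Z i)"
    and R: "0 < R" and bound: "AE \<mu> in M. L2_set (\<lambda>i. Z i \<mu>) I \<le> R"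
    and n: "1 \<le> n"
  defines "dev \<equiv> \<lambda>\<omega>. L2_set (\<lambda>i. (\<Sum>s=1..n. Z i (\<omega> s)) / real n - (\<integral>\<mu>. Z i \<mu> \<partial>M)) I"
  shows sample_mean_tail: "\<And>\<delta>. 0 < \<delta> \<Longrightarrow> \<delta> < 1 \<Longrightarrow>
      1 - \<delta> \<le> \<P>(\<omega> in iid n M. dev \<omega> < 2 * R * sqrt (2 * ln (2 / \<delta>) / real n))"
    and integrable_sample_mean_deviation: "integrable (iid n M) dev"
    and expectation_sample_mean_deviation: "(\<integral>\<omega>. dev \<omega> \<partial>iid n M) \<le> 4 * R / sqrt (real n)"
proof -
  interpret prob_space M by (rule M)
  define m where "m = (\<lambda>i. \<integral>\<mu>. Z i \<mu> \<partial>M)"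
  define Y where "Y = (\<lambda>i \<mu>. Z i \<mu> - m i)"
  define S where "S \<omega> = L2_set (\<lambda>i. \<Sum>s=1..n. Y i (\<omega> s)) I" for \<omega>
  have intY: "integrable M (Y i)" if "i \<in> I" for i
    unfolding Y_def using int[OF that] by auto
  have meanY: "(\<integral>\<mu>. Y i \<mu> \<partial>M) = 0" if "i \<in> I" for i
    unfolding Y_def m_def using int[OF that] by (simp add: prob_space)
  have mR: "L2_set m I \<le> R"
    unfolding m_def using M int bound R by (intro L2_set_mean_le) auto
  have "L2_set (\<lambda>i. Y i \<mu>) I \<le> 2 * R" if "L2_set (\<lambda>i. Z i \<mu>) I \<le> R" for \<mu>
    using L2_set_diff_le[of "\<lambda>i. Z i \<mu>" m I] mR that by (simp add: Y_def)
  then have boundY: "AE \<mu> in M. L2_set (\<lambda>i. Y i \<mu>) I \<le> 2 * R"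
    using bound by auto
  have R2: "0 < 2 * R" using R by simp
  note hyps = M intY meanY R2 boundY n
  have dev: "dev \<omega> = S \<omega> / real n" for \<omega>
  proof -
    have "(\<Sum>s=1..n. Z i (\<omega> s)) / real n - (\<integral>\<mu>. Z i \<mu> \<partial>M) = (1 / real n) * (\<Sum>s=1..n. Y i (\<omega> s))" for i
      using n by (simp add: Y_def m_def sum_subtractf field_simps)
    then have "dev \<omega> = L2_set (\<lambda>i. (1 / real n) * (\<Sum>s=1..n. Y i (\<omega> s))) I"
      by (simp only: dev_def)
    also have "\<dots> = (1 / real n) * S \<omega>"
      unfolding S_def by (rule L2_set_right_distrib[symmetric]) simp
    finally show ?thesis by simp
  qed
  then have dev_fun: "dev = (\<lambda>\<omega>. S \<omega> / real n)" by (rule ext)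
  have S: "integrable (iid n M) S" "(\<integral>\<omega>. S \<omega> \<partial>iid n M) \<le> 2 * (2 * R) * sqrt (real n)"
    using expectation_sum_iid[OF hyps] unfolding S_def by auto
  show "integrable (iid n M) dev"
    using S(1) unfolding dev_fun by simp
  have sqrt_div: "sqrt (x * real n) / real n = sqrt (x / real n)" for x
  proof -
    have "sqrt (x * real n) / real n = sqrt (x * real n / (real n)\<^sup>2)"
      by (simp add: real_sqrt_divide)
    also have "x * real n / (real n)\<^sup>2 = x / real n"
      using n by (simp add: power2_eq_square)
    finally show ?thesis .
  qed
  have "(\<integral>\<omega>. dev \<omega> \<partial>iid n M) \<le> 2 * (2 * R) * sqrt (real n) / real n"
    unfolding dev using S(2) by (simp add: divide_right_mono)
  also have "\<dots> = 4 * R / sqrt (real n)"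
  proof -
    have "sqrt (real n) / real n = 1 / sqrt (real n)"
      using sqrt_div[of 1] by (simp add: real_sqrt_divide)
    then have "2 * (2 * R) * (sqrt (real n) / real n) = 4 * R * (1 / sqrt (real n))" by simp
    then show ?thesis by (simp only: times_divide_eq_right mult_1_right)
  qed
  finally show "(\<integral>\<omega>. dev \<omega> \<partial>iid n M) \<le> 4 * R / sqrt (real n)" .
  fix \<delta> :: real assume \<delta>: "0 < \<delta>" "\<delta> < 1"
  interpret n: prob_space "iid n M" by (rule prob_space_iid[OF M])
  define t where "t = 2 * R * sqrt (2 * ln (2 / \<delta>) * real n)"
  have [measurable]: "S \<in> borel_measurable (iid n M)"
    using S(1) by (rule borel_measurable_integrable)
  have ln0: "0 < ln (2 / \<delta>)" using \<delta> by simp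
  then have t: "0 < t" using n R by (simp add: t_def)
  have "\<P>(\<omega> in iid n M. t \<le> S \<omega>) \<le> 2 * exp (- (t\<^sup>2 / (2 * real n * (2 * R)\<^sup>2)))"
    unfolding S_def by (rule tail_sum_iid[OF hyps t])
  also have "t\<^sup>2 / (2 * real n * (2 * R)\<^sup>2) = ln (2 / \<delta>)"
  proof -
    have "t\<^sup>2 = (2 * R)\<^sup>2 * (2 * ln (2 / \<delta>) * real n)"
      unfolding t_def power_mult_distrib[of "2 * R"] using ln0 by (subst real_sqrt_pow2) auto
    then show ?thesis using n R by simp
  qed
  also have "2 * exp (- ln (2 / \<delta>)) = \<delta>"
    using \<delta> by (simp add: exp_minus)
  finally have "1 - \<delta> \<le> 1 - \<P>(\<omega> in iid n M. t \<le> S \<omega>)" by simp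
  also have "\<dots> = \<P>(\<omega> in iid n M. \<not> t \<le> S \<omega>)"
    by (intro n.prob_neg[symmetric]) measurable
  also have "(\<lambda>\<omega>. \<not> t \<le> S \<omega>) = (\<lambda>\<omega>. dev \<omega> < 2 * R * sqrt (2 * ln (2 / \<delta>) / real n))"
  proof -
    have "t / real n = 2 * R * sqrt (2 * ln (2 / \<delta>) / real n)"
      unfolding t_def sqrt_div[symmetric] by (rule times_divide_eq_right[symmetric])
    moreover have "\<not> t \<le> S \<omega> \<longleftrightarrow> S \<omega> / real n < t / real n" for \<omega>
      using n by (simp add: divide_less_cancel not_le)
    ultimately show ?thesis by (simp only: dev)
  qed
  finally show "1 - \<delta> \<le> \<P>(\<omega> in iid n M. dev \<omega> < 2 * R * sqrt (2 * ln (2 / \<delta>) / real n))" .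
qed

section \<open>Spectral projections\<close>

text \<open>
  Matrices are functions on pairs of indices, so that the Frobenius scalar product is an instance of
  the scalar product of families. Constant weight 1 gives the orthogonal projection onto the span of
  orthonormal \<open>v k\<close>.
\<close>
definition spectral :: "nat set \<Rightarrow> (nat \<Rightarrow> real) \<Rightarrow> (nat \<Rightarrow> 'i \<Rightarrow> real) \<Rightarrow> 'i \<times> 'i \<Rightarrow> real" where
  "spectral K l v = (\<lambda>(i, j). \<Sum>k\<in>K. l k * v k i * v k j)"

text \<open>
  All scalar products of spectral projections and of the matrices themselves reduce to the squared
  overlaps of the two eigenbases.
\<close>
lemma dot_spectral:
  "dot (I \<times> I) (spectral K l v) (spectral K' l' w)
     = (\<Sum>j\<in>K. \<Sum>k\<in>K'. l j * l' k * (dot I (v j) (w k))\<^sup>2)"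
proof -
  have sq: "(dot I x y)\<^sup>2 = (\<Sum>(i, i')\<in>I \<times> I. x i * x i' * (y i * y i'))" for x y :: "'a \<Rightarrow> real"
    by (simp add: dot_def power2_eq_square sum_product sum.cartesian_product mult_ac)
  have "dot (I \<times> I) (spectral K l v) (spectral K' l' w)
      = (\<Sum>(i, i')\<in>I \<times> I. \<Sum>j\<in>K. \<Sum>k\<in>K'. l j * l' k * (v j i * v j i' * (w k i * w k i')))"
    unfolding dot_def spectral_def by (intro sum.cong) (auto simp: sum_product mult_ac)
  also have "\<dots> = (\<Sum>j\<in>K. \<Sum>k\<in>K'. \<Sum>(i, i')\<in>I \<times> I. l j * l' k * (v j i * v j i' * (w k i * w k i')))"
    unfolding case_prod_unfold by (subst sum.swap, intro sum.cong refl, subst sum.swap) (rule refl)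
  also have "\<dots> = (\<Sum>j\<in>K. \<Sum>k\<in>K'. l j * l' k * (dot I (v j) (w k))\<^sup>2)"
    unfolding sq by (simp add: sum_distrib_left case_prod_unfold)
  finally show ?thesis .
qed

definition orthonormal_basis :: "nat \<Rightarrow> (nat \<Rightarrow> nat \<Rightarrow> real) \<Rightarrow> bool" where
  "orthonormal_basis N v \<longleftrightarrow>
     (\<forall>j\<in>{1..N}. \<forall>k\<in>{1..N}. dot {..<N} (v j) (v k) = (if j = k then 1 else 0))"

text \<open>
  Orthonormality says that the square matrix of the \<open>v k\<close> has its transpose as right inverse; over a
  field it is then also a left inverse.
\<close>
lemma orthonormal_basis_completeness:
  assumes v: "orthonormal_basis N v" and i: "i < N" and j: "j < N"
  shows "(\<Sum>k=1..N. v k i * v k j) = (if i = j then 1 else 0)"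
proof -
  define V where "V = mat N N (\<lambda>(k, i). v (Suc k) i)"
  have V: "V \<in> carrier_mat N N" and VT: "transpose_mat V \<in> carrier_mat N N"
    by (auto simp: V_def)
  have "V * transpose_mat V = 1\<^sub>m N"
  proof (rule eq_matI)
    fix a b assume ab: "a < dim_row (1\<^sub>m N :: real mat)" "b < dim_col (1\<^sub>m N :: real mat)"
    then have "(V * transpose_mat V) $$ (a, b) = dot {..<N} (v (Suc a)) (v (Suc b))"
      by (simp add: V_def scalar_prod_def dot_def atLeast0LessThan)
    then show "(V * transpose_mat V) $$ (a, b) = 1\<^sub>m N $$ (a, b)"
      using v ab by (simp add: orthonormal_basis_def)
  qed (auto simp: V_def)
  then have "transpose_mat V * V = 1\<^sub>m N"
    by (rule mat_mult_left_right_inverse[OF V VT])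
  then have "(transpose_mat V * V) $$ (i, j) = 1\<^sub>m N $$ (i, j)" by simp
  then have "(\<Sum>k<N. v (Suc k) i * v (Suc k) j) = (if i = j then 1 else 0)"
    using i j by (simp add: V_def scalar_prod_def atLeast0LessThan)
  then show ?thesis
    by (simp add: sum.atLeast1_atMost_eq lessThan_Suc_atMost)
qed

lemma orthonormal_basis_parseval:
  assumes "orthonormal_basis N v"
  shows "(\<Sum>k=1..N. (dot {..<N} (v k) x)\<^sup>2) = dot {..<N} x x"
proof -
  have "(\<Sum>k=1..N. (dot {..<N} (v k) x)\<^sup>2)
      = (\<Sum>k=1..N. \<Sum>i<N. \<Sum>j<N. (v k i * v k j) * (x i * x j))"
    by (simp add: dot_def power2_eq_square sum_product mult_ac)
  also have "\<dots> = (\<Sum>i<N. \<Sum>k=1..N. \<Sum>j<N. (v k i * v k j) * (x i * x j))"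
    by (rule sum.swap)
  also have "\<dots> = (\<Sum>i<N. \<Sum>j<N. (\<Sum>k=1..N. v k i * v k j) * (x i * x j))"
    unfolding sum_distrib_right by (intro sum.cong refl sum.swap)
  also have "\<dots> = (\<Sum>i<N. \<Sum>j<N. (if i = j then 1 else 0) * (x i * x j))"
    using orthonormal_basis_completeness[OF assms] by (intro sum.cong refl) simp
  also have "\<dots> = dot {..<N} x x"
    unfolding dot_def by (intro sum.cong refl) (simp add: if_distrib[of "\<lambda>c. c * _"] cong: if_cong)
  finally show ?thesis .
qed

abbreviation leading :: "nat \<Rightarrow> (nat \<Rightarrow> nat \<Rightarrow> real) \<Rightarrow> nat \<times> nat \<Rightarrow> real" where
  "leading r v \<equiv> spectral {1..r} (\<lambda>_. 1) v"

abbreviation frob :: "nat \<Rightarrow> (nat \<times> nat \<Rightarrow> real) \<Rightarrow> real" where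
  "frob N A \<equiv> L2_set A ({..<N} \<times> {..<N})"

text \<open>
  Let \<open>q j\<close> be the squared length of the projection of \<open>v j\<close> onto the span of the first \<open>r\<close> vectors
  of \<open>w\<close>. The \<open>q j\<close> lie between 0 and 1 and sum to \<open>r\<close>. Passing from the projection of \<open>v\<close> to that
  of \<open>w\<close> moves the weight \<open>r - (q 1 + \<dots> + q r)\<close> from eigenvalues at least \<open>a\<close> to eigenvalues at most
  \<open>b\<close>, and twice this weight is the squared distance of the projections. For \<open>a = b\<close> this is
  Ky Fan's maximum principle.
\<close>
lemma gap_projection_le:
  assumes v: "orthonormal_basis N v" and w: "orthonormal_basis N w" and r: "r \<le> N"
    and hi: "\<And>j. j \<in> {1..r} \<Longrightarrow> a \<le> l j" and lo: "\<And>j. j \<in> {Suc r..N} \<Longrightarrow> l j \<le> b"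
  shows "(a - b) * (frob N (\<lambda>x. leading r v x - leading r w x))\<^sup>2
           \<le> 2 * dot ({..<N} \<times> {..<N}) (spectral {1..N} l v) (\<lambda>x. leading r v x - leading r w x)"
proof -
  let ?A = "spectral {1..N} l v"
  define q where "q = (\<lambda>j. \<Sum>k=1..r. (dot {..<N} (v j) (w k))\<^sup>2)"
  have vv: "dot {..<N} (v j) (v k) = (if j = k then 1 else 0)" if "j \<in> {1..N}" "k \<in> {1..N}" for j k
    using v that by (auto simp: orthonormal_basis_def)
  have ww: "dot {..<N} (w j) (w k) = (if j = k then 1 else 0)" if "j \<in> {1..N}" "k \<in> {1..N}" for j k
    using w that by (auto simp: orthonormal_basis_def)
  have q1: "q j \<le> 1" if "j \<in> {1..N}" for j
  proof -
    have "q j \<le> (\<Sum>k=1..N. (dot {..<N} (w k) (v j))\<^sup>2)"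
      unfolding q_def dot_commute[of _ "v j"] by (rule sum_mono2) (use r in auto)
    also have "\<dots> = 1"
      unfolding orthonormal_basis_parseval[OF w] using vv[OF that that] by simp
    finally show ?thesis .
  qed
  have q0: "0 \<le> q j" for j unfolding q_def by (simp add: sum_nonneg)
  have "(\<Sum>j=1..N. q j) = (\<Sum>k=1..r. \<Sum>j=1..N. (dot {..<N} (v j) (w k))\<^sup>2)"
    unfolding q_def by (rule sum.swap)
  also have "\<dots> = (\<Sum>k=1..r. 1)"
    unfolding orthonormal_basis_parseval[OF v] using r by (intro sum.cong refl) (simp add: ww)
  finally have sumq: "(\<Sum>j=1..N. q j) = real r" by simp
  have split: "(\<Sum>j=1..N. f j) = (\<Sum>j=1..r. f j) + (\<Sum>j=Suc r..N. f j)" for f :: "nat \<Rightarrow> real"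
    using r sum.ub_add_nat[of 1 r f "N - r"] by simp
  define s where "s = (\<Sum>j=1..r. q j)"
  have tail: "(\<Sum>j=Suc r..N. q j) = real r - s"
    using sumq split[of q] by (simp add: s_def)
  have diag: "(\<Sum>k=1..r. c * (dot {..<N} (u j) (u k))\<^sup>2) = (if j \<le> r then c else 0)"
    if "orthonormal_basis N u" "j \<in> {1..N}" for c j and u :: "nat \<Rightarrow> nat \<Rightarrow> real"
  proof -
    have "(\<Sum>k=1..r. c * (dot {..<N} (u j) (u k))\<^sup>2) = (\<Sum>k=1..r. if k = j then c else 0)"
      using that r by (intro sum.cong refl) (auto simp: orthonormal_basis_def)
    then show ?thesis using that by simp
  qed
  have norm: "(frob N (\<lambda>x. leading r v x - leading r w x))\<^sup>2 = 2 * (real r - s)"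
  proof -
    have "dot ({..<N} \<times> {..<N}) (leading r u) (leading r u) = real r" if "orthonormal_basis N u" for u
    proof -
      have "dot ({..<N} \<times> {..<N}) (leading r u) (leading r u) = (\<Sum>j=1..r. 1)"
        unfolding dot_spectral using r diag[OF that, where c = 1] by (intro sum.cong refl) simp
      then show ?thesis by simp
    qed
    moreover have "dot ({..<N} \<times> {..<N}) (leading r v) (leading r w) = s"
      unfolding dot_spectral s_def q_def by simp
    ultimately show ?thesis using v w by (simp add: L2_set_diff_power2)
  qed
  have "dot ({..<N} \<times> {..<N}) ?A (leading r v) = (\<Sum>j=1..N. if j \<le> r then l j else 0)"
    unfolding dot_spectral using diag[OF v] by (intro sum.cong refl) simp
  also have "\<dots> = (\<Sum>j=1..r. l j)"
    unfolding split by simp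
  finally have Av: "dot ({..<N} \<times> {..<N}) ?A (leading r v) = (\<Sum>j=1..r. l j)" .
  have Aw: "dot ({..<N} \<times> {..<N}) ?A (leading r w) = (\<Sum>j=1..N. l j * q j)"
    unfolding dot_spectral q_def by (simp add: sum_distrib_left)
  have "(a - b) * (real r - s) = (\<Sum>j=1..r. a * (1 - q j)) - (\<Sum>j=Suc r..N. b * q j)"
    by (simp add: right_diff_distrib sum_subtractf s_def tail flip: sum_distrib_left) (simp add: algebra_simps)
  also have "\<dots> \<le> (\<Sum>j=1..r. l j * (1 - q j)) - (\<Sum>j=Suc r..N. l j * q j)"
    using hi lo q0 q1 r by (intro diff_mono sum_mono mult_right_mono) auto
  also have "\<dots> = (\<Sum>j=1..r. l j) - (\<Sum>j=1..N. l j * q j)"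
    unfolding split by (simp add: right_diff_distrib sum_subtractf)
  finally show ?thesis
    unfolding norm dot_diff_right Av Aw by (simp add: algebra_simps)
qed

text \<open>
  The eigenvalues \<open>l'\<close> of the perturbed matrix enter only through their order: Ky Fan's principle for
  the perturbed matrix takes the place of Weyl's inequality, so no eigenvalue of the two
  matrices is ever compared.
\<close>
lemma davis_kahan_leading:
  assumes v: "orthonormal_basis N v" and w: "orthonormal_basis N w" and r: "r \<le> N"
    and mono: "\<And>j k. j \<in> {1..N} \<Longrightarrow> k \<in> {1..N} \<Longrightarrow> j \<le> k \<Longrightarrow> l' k \<le> l' j"
    and hi: "\<And>j. j \<in> {1..r} \<Longrightarrow> a \<le> l j" and lo: "\<And>j. j \<in> {Suc r..N} \<Longrightarrow> l j \<le> b"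
    and gap: "g \<le> a - b"
  shows "g * frob N (\<lambda>x. leading r v x - leading r w x) \<le> 2 * frob N (\<lambda>x. spectral {1..N} l' w x - spectral {1..N} l v x)"
proof -
  let ?A = "spectral {1..N} l v" and ?B = "spectral {1..N} l' w"
  let ?I = "{..<N} \<times> {..<N}" and ?D = "\<lambda>x. leading r v x - leading r w x"
  have neg: "dot ?I ?B (\<lambda>x. leading r w x - leading r v x) = - dot ?I ?B ?D"
    by (simp add: dot_diff_right)
  have "0 \<le> - dot ?I ?B ?D"
  proof (cases "r = 0")
    case True then show ?thesis by (simp add: dot_def spectral_def case_prod_unfold)
  next
    case False
    from gap_projection_le[OF w v r, where l = "l'" and a = "l' r" and b = "l' r"] show ?thesis
      unfolding neg using mono r False by simp
  qed
  moreover have "dot ?I ?A ?D = dot ?I ?B ?D - dot ?I (\<lambda>x. ?B x - ?A x) ?D"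
    by (simp add: dot_diff_left)
  ultimately have "dot ?I ?A ?D \<le> frob N (\<lambda>x. ?B x - ?A x) * frob N ?D"
    using abs_dot_le[of ?I "\<lambda>x. ?B x - ?A x" ?D] by linarith
  moreover have "g * (frob N ?D)\<^sup>2 \<le> (a - b) * (frob N ?D)\<^sup>2"
    using gap by (rule mult_right_mono) simp
  moreover have "(a - b) * (frob N ?D)\<^sup>2 \<le> 2 * dot ?I ?A ?D"
    by (rule gap_projection_le[OF v w r hi lo])
  ultimately have "(g * frob N ?D) * frob N ?D \<le> (2 * frob N (\<lambda>x. ?B x - ?A x)) * frob N ?D"
    by (simp add: power2_eq_square)
  then show ?thesis
  proof (cases "frob N ?D = 0")
    case False
    then have "0 < frob N ?D" using L2_set_nonneg[of ?D ?I] by linarith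
    with \<open>(g * frob N ?D) * frob N ?D \<le> _\<close> show ?thesis by (rule mult_right_le_imp_le)
  qed simp
qed

text \<open>
  A rank-one spectral projection is the difference of two consecutive leading projections, one for
  each side of the gap around the \<open>k\<close>-th eigenvalue. At \<open>k = 1\<close> the lower one is zero, and at
  \<open>k = N\<close> the upper one leaves no eigenvalue below, so any value serves as the bound \<open>b\<close> there.
\<close>
lemma davis_kahan_vector:
  assumes v: "orthonormal_basis N v" and w: "orthonormal_basis N w" and k: "k \<in> {1..N}"
    and mono: "\<And>j k. j \<in> {1..N} \<Longrightarrow> k \<in> {1..N} \<Longrightarrow> j \<le> k \<Longrightarrow> l k \<le> l j"
    and mono': "\<And>j k. j \<in> {1..N} \<Longrightarrow> k \<in> {1..N} \<Longrightarrow> j \<le> k \<Longrightarrow> l' k \<le> l' j"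
    and gap: "1 < k \<Longrightarrow> g \<le> l (k - 1) - l k" "k < N \<Longrightarrow> g \<le> l k - l (Suc k)"
    and g: "0 < g"
  shows "g * sqrt (1 - (dot {..<N} (v k) (w k))\<^sup>2) \<le> 2 * sqrt 2 * frob N (\<lambda>x. spectral {1..N} l' w x - spectral {1..N} l v x)"
proof -
  let ?A = "spectral {1..N} l v" and ?B = "spectral {1..N} l' w"
  let ?I = "{..<N} \<times> {..<N}" and ?E = "frob N (\<lambda>x. ?B x - ?A x)"
  let ?D = "\<lambda>r x. leading r v x - leading r w x"
  have upper: "g * frob N (?D k) \<le> 2 * ?E"
  proof (cases "k < N")
    case True
    show ?thesis
      by (rule davis_kahan_leading[OF v w _ mono', where a = "l k" and b = "l (Suc k)"])
        (use True k mono gap in auto)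
  next
    case False
    show ?thesis
      by (rule davis_kahan_leading[OF v w _ mono', where a = "l k" and b = "l k - g"])
        (use False k mono in auto)
  qed
  have lower: "g * frob N (?D (k - 1)) \<le> 2 * ?E"
  proof (cases "1 < k")
    case True
    show ?thesis
      by (rule davis_kahan_leading[OF v w _ mono', where a = "l (k - 1)" and b = "l k"])
        (use True k mono gap in auto)
  next
    case False
    then have "k = 1" using k by simp
    then show ?thesis by (simp add: spectral_def case_prod_unfold L2_set_0')
  qed
  let ?P = "\<lambda>u. spectral {k} (\<lambda>_. 1) u"
  have single: "leading k u x - leading (k - 1) u x = ?P u x" for u x
  proof -
    obtain m where "k = Suc m" using k by (cases k) auto
    then show ?thesis by (simp add: spectral_def case_prod_unfold)
  qed
  have "(\<lambda>x. ?D k x - ?D (k - 1) x) = (\<lambda>x. ?P v x - ?P w x)"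
    unfolding single[symmetric] by (simp add: algebra_simps)
  then have "frob N (\<lambda>x. ?P v x - ?P w x) \<le> frob N (?D k) + frob N (?D (k - 1))"
    using L2_set_diff_le[of "?D k" "?D (k - 1)" ?I] by simp
  then have "g * frob N (\<lambda>x. ?P v x - ?P w x) \<le> g * frob N (?D k) + g * frob N (?D (k - 1))"
    using g by (simp flip: distrib_left)
  with upper lower have "g * frob N (\<lambda>x. ?P v x - ?P w x) \<le> 4 * ?E" by linarith
  moreover have "frob N (\<lambda>x. ?P v x - ?P w x) = sqrt 2 * sqrt (1 - (dot {..<N} (v k) (w k))\<^sup>2)"
  proof -
    have "(frob N (\<lambda>x. ?P v x - ?P w x))\<^sup>2 = 2 * (1 - (dot {..<N} (v k) (w k))\<^sup>2)"
      using v w k unfolding L2_set_diff_power2 dot_spectral by (simp add: orthonormal_basis_def)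
    from real_sqrt_unique[OF this L2_set_nonneg] show ?thesis by (simp only: real_sqrt_mult)
  qed
  ultimately have "sqrt 2 * (g * sqrt (1 - (dot {..<N} (v k) (w k))\<^sup>2)) \<le> 4 * ?E"
    by (simp add: mult_ac)
  also have "4 * ?E = (sqrt 2 * sqrt 2) * (2 * ?E)" by simp
  also have "\<dots> = sqrt 2 * (2 * sqrt 2 * ?E)" by (simp only: mult_ac)
  finally show ?thesis by (rule mult_left_le_imp_le) simp
qed

section \<open>Matrices and their eigensystems\<close>

abbreviation entries :: "real mat \<Rightarrow> nat \<times> nat \<Rightarrow> real" where
  "entries A \<equiv> \<lambda>x. A $$ x"

lemma norm2_L2_set: "x \<in> carrier_vec N \<Longrightarrow> norm2 x = L2_set (\<lambda>i. x $ i) {..<N}"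
  by (simp add: norm2_def scalar_prod_def L2_set_def power2_eq_square atLeast0LessThan)

lemma scalar_prod_dot:
  "y \<in> carrier_vec N \<Longrightarrow> scalar_prod x y = dot {..<N} (\<lambda>i. x $ i) (\<lambda>i. y $ i)"
  by (simp add: scalar_prod_def dot_def atLeast0LessThan)

lemma norm2_mult_mat_vec:
  assumes "A \<in> carrier_mat N N" "x \<in> carrier_vec N"
  shows "norm2 (A *\<^sub>v x) = L2_set (\<lambda>i. \<Sum>j<N. A $$ (i, j) * x $ j) {..<N}"
proof -
  have "norm2 (A *\<^sub>v x) = L2_set (\<lambda>i. (A *\<^sub>v x) $ i) {..<N}"
    using assms by (intro norm2_L2_set) auto
  also have "\<dots> = L2_set (\<lambda>i. \<Sum>j<N. A $$ (i, j) * x $ j) {..<N}"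
    using assms by (intro L2_set_cong refl) (simp add: scalar_prod_def atLeast0LessThan)
  finally show ?thesis .
qed

lemma L2_set_mult_frob_le:
  "L2_set (\<lambda>i. \<Sum>j<N. A (i, j) * x j) {..<N} \<le> frob N A * L2_set x {..<N}"
proof -
  have row: "\<bar>\<Sum>j<N. A (i, j) * x j\<bar> \<le> L2_set (\<lambda>j. A (i, j)) {..<N} * L2_set x {..<N}" for i
    using abs_dot_le[of "{..<N}" "\<lambda>j. A (i, j)" x] by (simp add: dot_def)
  have "L2_set (\<lambda>i. \<Sum>j<N. A (i, j) * x j) {..<N} = L2_set (\<lambda>i. \<bar>\<Sum>j<N. A (i, j) * x j\<bar>) {..<N}"
    by (simp add: L2_set_def)
  also have "\<dots> \<le> L2_set (\<lambda>i. L2_set (\<lambda>j. A (i, j)) {..<N} * L2_set x {..<N}) {..<N}"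
    using row by (intro L2_set_mono) auto
  also have "\<dots> = L2_set (\<lambda>i. L2_set (\<lambda>j. A (i, j)) {..<N}) {..<N} * L2_set x {..<N}"
    by (rule L2_set_left_distrib[symmetric]) simp
  also have "L2_set (\<lambda>i. L2_set (\<lambda>j. A (i, j)) {..<N}) {..<N} = frob N A"
    by (simp add: L2_set_def sum_nonneg sum.cartesian_product)
  finally show ?thesis .
qed

text \<open>
  Removing the normalisation from the supremum lets the test vectors range over all vectors, so that
  they can be restricted to rational ones later.
\<close>
lemma spectral_norm_le_iff:
  assumes A: "A \<in> carrier_mat N N" and N: "0 < N"
  shows "spectral_norm A \<le> c \<longleftrightarrow>
    (\<forall>x. L2_set (\<lambda>i. \<Sum>j<N. A $$ (i, j) * x j) {..<N} \<le> c * L2_set x {..<N})" (is "_ \<longleftrightarrow> ?R")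
proof -
  let ?U = "{x \<in> carrier_vec N. norm2 x = 1}"
  have ne: "?U \<noteq> {}"
  proof -
    have "unit_vec N 0 \<in> ?U" using N by (simp add: norm2_def)
    then show ?thesis by blast
  qed
  have bdd: "bdd_above ((\<lambda>x. norm2 (A *\<^sub>v x)) ` ?U)"
  proof (rule bdd_aboveI2)
    fix x assume "x \<in> ?U"
    then have x: "x \<in> carrier_vec N" and "L2_set (\<lambda>j. x $ j) {..<N} = 1"
      using norm2_L2_set[of x N] by auto
    then show "norm2 (A *\<^sub>v x) \<le> frob N (entries A)"
      using L2_set_mult_frob_le[where N = N and A = "entries A" and x = "\<lambda>j. x $ j"] A
      by (simp add: norm2_mult_mat_vec)
  qed
  have "spectral_norm A \<le> c \<longleftrightarrow> (\<forall>x\<in>?U. norm2 (A *\<^sub>v x) \<le> c)"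
    unfolding spectral_norm_def using A cSUP_le_iff[OF ne bdd] by simp
  also have "\<dots> \<longleftrightarrow> ?R"
  proof (intro iffI allI ballI)
    fix x assume R: ?R and x: "x \<in> ?U"
    from x have "x \<in> carrier_vec N" and "L2_set (\<lambda>j. x $ j) {..<N} = 1"
      using norm2_L2_set[of x N] by auto
    then show "norm2 (A *\<^sub>v x) \<le> c"
      using R[rule_format, of "\<lambda>j. x $ j"] A by (simp add: norm2_mult_mat_vec)
  next
    fix x :: "nat \<Rightarrow> real" assume U: "\<forall>x\<in>?U. norm2 (A *\<^sub>v x) \<le> c"
    let ?n = "L2_set x {..<N}"
    show "L2_set (\<lambda>i. \<Sum>j<N. A $$ (i, j) * x j) {..<N} \<le> c * ?n"
    proof (cases "?n = 0")
      case True
      then show ?thesis by (simp add: L2_set_eq_0_iff L2_set_0')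
    next
      case False
      then have n: "0 < ?n" using L2_set_nonneg[of x "{..<N}"] by linarith
      define y where "y = vec N (\<lambda>j. x j / ?n)"
      have y: "y \<in> carrier_vec N" by (simp add: y_def)
      have "norm2 y = L2_set (\<lambda>j. inverse ?n * x j) {..<N}"
        unfolding norm2_L2_set[OF y] by (intro L2_set_cong) (auto simp: y_def divide_inverse_commute)
      also have "\<dots> = inverse ?n * ?n"
        by (rule L2_set_right_distrib[symmetric]) simp
      finally have "norm2 y = 1" using n by simp
      with U y have "norm2 (A *\<^sub>v y) \<le> c" by simp
      also have "norm2 (A *\<^sub>v y) = L2_set (\<lambda>i. inverse ?n * (\<Sum>j<N. A $$ (i, j) * x j)) {..<N}"
        unfolding norm2_mult_mat_vec[OF A y]
        by (intro L2_set_cong refl) (simp add: y_def sum_distrib_left divide_inverse mult_ac)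
      also have "\<dots> = inverse ?n * L2_set (\<lambda>i. \<Sum>j<N. A $$ (i, j) * x j) {..<N}"
        by (rule L2_set_right_distrib[symmetric]) simp
      finally show ?thesis using n by (simp add: field_simps)
    qed
  qed
  finally show ?thesis .
qed

lemma spectral_norm_le_frob:
  assumes "A \<in> carrier_mat N N" and "0 < N"
  shows "spectral_norm A \<le> frob N (entries A)"
  unfolding spectral_norm_le_iff[OF assms] using L2_set_mult_frob_le[where N = N and A = "entries A"] by blast

section \<open>Measurability of the spectral norm\<close>

text \<open>
  Both sides are continuous in the test vector and rational vectors are dense. This replaces an
  uncountable family of conditions by a countable one.
\<close>
lemma all_rational_vectors_iff:
  fixes B :: "nat \<Rightarrow> nat \<Rightarrow> real"
  shows "(\<forall>x. L2_set (\<lambda>i. \<Sum>j<N. B i j * x j) {..<N} \<le> c * L2_set x {..<N}) \<longleftrightarrow>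
     (\<forall>x\<in>{..<N} \<rightarrow>\<^sub>E \<rat>. L2_set (\<lambda>i. \<Sum>j<N. B i j * x j) {..<N} \<le> c * L2_set x {..<N})"
    (is "_ \<longleftrightarrow> (\<forall>x\<in>?Q. ?P x)")
proof (intro iffI allI ballI)
  fix x :: "nat \<Rightarrow> real" assume Q: "\<forall>x\<in>?Q. ?P x"
  have "\<exists>q\<in>\<rat>. \<bar>q - x i\<bar> < inverse (real (Suc m))" for i m
  proof -
    obtain q where "q \<in> \<rat>" "x i < q" "q < x i + inverse (real (Suc m))"
      using Rats_dense_in_real[of "x i" "x i + inverse (real (Suc m))"] by auto
    then show ?thesis by (intro bexI[of _ q]) auto
  qed
  then obtain q where q: "\<And>i m. q i m \<in> \<rat>" "\<And>i m. \<bar>q i m - x i\<bar> < inverse (real (Suc m))"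
    by metis
  define y where "y m = (\<lambda>i\<in>{..<N}. q i m)" for m
  have y: "y m \<in> ?Q" for m by (auto simp: y_def q)
  have lim: "(\<lambda>m. y m i) \<longlonglongrightarrow> x i" if "i < N" for i
  proof -
    have "(\<lambda>m. q i m - x i) \<longlonglongrightarrow> 0"
      by (rule Lim_null_comparison[OF _ LIMSEQ_inverse_real_of_nat])
        (use q(2) in \<open>auto intro!: always_eventually less_imp_le\<close>)
    then show ?thesis using that by (simp add: y_def LIM_zero_iff)
  qed
  have "(\<lambda>m. L2_set (\<lambda>i. \<Sum>j<N. B i j * y m j) {..<N}) \<longlonglongrightarrow> L2_set (\<lambda>i. \<Sum>j<N. B i j * x j) {..<N}"
    unfolding L2_set_def by (intro tendsto_intros lim) auto
  moreover have "(\<lambda>m. c * L2_set (y m) {..<N}) \<longlonglongrightarrow> c * L2_set x {..<N}"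
    unfolding L2_set_def by (intro tendsto_intros lim) auto
  ultimately show "?P x"
    by (rule LIMSEQ_le) (use Q y in blast)
qed blast

lemma borel_measurable_spectral_norm:
  assumes A: "\<And>\<omega>. \<omega> \<in> space M \<Longrightarrow> A \<omega> \<in> carrier_mat N N" and N: "0 < N"
    and meas: "\<And>i j. i < N \<Longrightarrow> j < N \<Longrightarrow> (\<lambda>\<omega>. A \<omega> $$ (i, j)) \<in> borel_measurable M"
  shows "(\<lambda>\<omega>. spectral_norm (A \<omega>)) \<in> borel_measurable M"
proof (rule borel_measurableI_le)
  fix c
  let ?Q = "{..<N} \<rightarrow>\<^sub>E (\<rat> :: real set)"
  let ?f = "\<lambda>x \<omega>. L2_set (\<lambda>i. \<Sum>j<N. A \<omega> $$ (i, j) * x j) {..<N}"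
  have f: "?f x \<in> borel_measurable M" for x
    unfolding L2_set_def
    by (intro measurable_compose[OF _ borel_measurable_sqrt] borel_measurable_sum
        borel_measurable_power borel_measurable_times borel_measurable_const meas) auto
  have "{\<omega> \<in> space M. spectral_norm (A \<omega>) \<le> c} = {\<omega> \<in> space M. \<forall>x\<in>?Q. ?f x \<omega> \<le> c * L2_set x {..<N}}"
    using spectral_norm_le_iff[OF A N] all_rational_vectors_iff by auto
  also have "\<dots> \<in> sets M"
  proof (rule sets.sets_Collect_countable_All')
    show "countable ?Q" by (intro countable_PiE countable_rat) auto
    show "{\<omega> \<in> space M. ?f x \<omega> \<le> c * L2_set x {..<N}} \<in> sets M" for x
      by (rule borel_measurable_le[OF f borel_measurable_const])
  qed
  finally show "{\<omega> \<in> space M. spectral_norm (A \<omega>) \<le> c} \<in> sets M" .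
qed

section \<open>Perturbation of eigenvectors and spectral projections\<close>

text \<open>
  The spectral decomposition follows from completeness of the eigenbasis, applied to the rows of \<open>A\<close>:
  the eigenvector equation turns \<open>l k * v k $ i\<close> into the \<open>i\<close>-th entry of the product of \<open>A\<close> with \<open>v k\<close>.
\<close>
lemma ordered_eigensystemD:
  assumes sys: "ordered_eigensystem N A l v" and A: "A \<in> carrier_mat N N"
  shows eigensystem_carrier: "\<And>k. k \<in> {1..N} \<Longrightarrow> v k \<in> carrier_vec N"
    and eigensystem_orthonormal: "orthonormal_basis N (\<lambda>k i. v k $ i)"
    and eigensystem_spectral: "\<And>x. x \<in> {..<N} \<times> {..<N} \<Longrightarrow> A $$ x = spectral {1..N} l (\<lambda>k i. v k $ i) x"
    and eigensystem_mono: "\<And>j k. j \<in> {1..N} \<Longrightarrow> k \<in> {1..N} \<Longrightarrow> j \<le> k \<Longrightarrow> l k \<le> l j"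
proof -
  have ev: "eigenvector A (v k) (l k)" if "k \<in> {1..N}" for k
    using sys that by (simp add: ordered_eigensystem_def)
  show carrier: "v k \<in> carrier_vec N" if "k \<in> {1..N}" for k
    using ev[OF that] A by (simp add: eigenvector_def)
  show ortho: "orthonormal_basis N (\<lambda>k i. v k $ i)"
    unfolding orthonormal_basis_def
  proof (intro ballI)
    fix j k assume "j \<in> {1..N}" "k \<in> {1..N}"
    then have "scalar_prod (v j) (v k) = (if j = k then 1 else 0)"
      using sys unfolding ordered_eigensystem_def by blast
    then show "dot {..<N} (\<lambda>i. v j $ i) (\<lambda>i. v k $ i) = (if j = k then 1 else 0)"
      using scalar_prod_dot[OF carrier[OF \<open>k \<in> {1..N}\<close>], of "v j"] by simp
  qed
  show "l k \<le> l j" if "j \<in> {1..N}" "k \<in> {1..N}" "j \<le> k" for j k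
    using sys that unfolding ordered_eigensystem_def by blast
  fix x assume "x \<in> {..<N} \<times> {..<N}"
  then obtain i j where x: "x = (i, j)" and i: "i < N" and j: "j < N" by auto
  have row: "l k * v k $ i = (\<Sum>m<N. A $$ (i, m) * v k $ m)" if k: "k \<in> {1..N}" for k
  proof -
    have "(A *\<^sub>v v k) $ i = (l k \<cdot>\<^sub>v v k) $ i"
      using ev[OF k] by (simp add: eigenvector_def)
    then show ?thesis
      using A i carrier[OF k] by (simp add: scalar_prod_def atLeast0LessThan)
  qed
  have "spectral {1..N} l (\<lambda>k i. v k $ i) x = (\<Sum>k=1..N. \<Sum>m<N. A $$ (i, m) * (v k $ m * v k $ j))"
    unfolding x spectral_def prod.case
    by (intro sum.cong refl) (simp add: row sum_distrib_right mult.assoc)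
  also have "\<dots> = (\<Sum>m<N. A $$ (i, m) * (\<Sum>k=1..N. v k $ m * v k $ j))"
    unfolding sum_distrib_left by (rule sum.swap)
  also have "\<dots> = (\<Sum>m<N. if m = j then A $$ (i, m) else 0)"
    using orthonormal_basis_completeness[OF ortho _ j] by (intro sum.cong refl) simp
  also have "\<dots> = A $$ x" using j by (simp add: x)
  finally show "A $$ x = spectral {1..N} l (\<lambda>k i. v k $ i) x" by simp
qed

lemma sin_line_angle:
  assumes "x \<in> carrier_vec N" "y \<in> carrier_vec N" "scalar_prod x x = 1" "scalar_prod y y = 1"
  shows "sin (line_angle x y) = sqrt (1 - (dot {..<N} (\<lambda>i. x $ i) (\<lambda>i. y $ i))\<^sup>2)"
proof -
  have "L2_set (\<lambda>i. x $ i) {..<N} = 1" "L2_set (\<lambda>i. y $ i) {..<N} = 1"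
    using assms by (simp_all add: norm2_def flip: norm2_L2_set)
  then have "\<bar>scalar_prod x y\<bar> \<le> 1"
    using abs_dot_le[of "{..<N}" "\<lambda>i. x $ i" "\<lambda>i. y $ i"] assms(2) by (simp add: scalar_prod_dot)
  then show ?thesis
    unfolding line_angle_def using assms(2) by (subst sin_arccos) (auto simp: scalar_prod_dot)
qed

lemma eigengap_le_upper:
  assumes "k \<le> N" "1 < k"
  shows "eigengap N l k \<le> l (k - 1) - l k"
  using assms by (auto simp: eigengap_def padded_eigenvalue_def min_def)

lemma eigengap_le_lower:
  assumes "1 \<le> k" "k < N"
  shows "eigengap N l k \<le> l k - l (Suc k)"
  using assms by (auto simp: eigengap_def padded_eigenvalue_def min_def split: if_splits)

lemma frob_cong: "(\<And>x. x \<in> {..<N} \<times> {..<N} \<Longrightarrow> A x = B x) \<Longrightarrow> frob N A = frob N B"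
  by (rule L2_set_cong) auto

lemma sin_line_angle_eigenvectors_le:
  assumes A: "A \<in> carrier_mat N N" "ordered_eigensystem N A l v"
    and B: "B \<in> carrier_mat N N" "ordered_eigensystem N B l' w"
    and k: "k \<in> {1..N}" and gap: "0 < eigengap N l k"
  shows "sin (line_angle (v k) (w k))
    = sqrt (1 - (dot {..<N} (\<lambda>i. v k $ i) (\<lambda>i. w k $ i))\<^sup>2)" (is ?eq)
    and "sin (line_angle (v k) (w k)) \<le> 2 * sqrt 2 / eigengap N l k * frob N (\<lambda>x. B $$ x - A $$ x)"
proof -
  note a = ordered_eigensystemD[OF A(2,1)] and b = ordered_eigensystemD[OF B(2,1)]
  show eq: ?eq
    using A(2) B(2) k by (intro sin_line_angle a b) (auto simp: ordered_eigensystem_def)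
  have "frob N (\<lambda>x. spectral {1..N} l' (\<lambda>k i. w k $ i) x - spectral {1..N} l (\<lambda>k i. v k $ i) x)
      = frob N (\<lambda>x. B $$ x - A $$ x)"
    by (rule frob_cong) (simp only: a(3) b(3))
  moreover have "eigengap N l k * sqrt (1 - (dot {..<N} (\<lambda>i. v k $ i) (\<lambda>i. w k $ i))\<^sup>2) \<le> 2 * sqrt 2 *
      frob N (\<lambda>x. spectral {1..N} l' (\<lambda>k i. w k $ i) x - spectral {1..N} l (\<lambda>k i. v k $ i) x)"
    by (rule davis_kahan_vector[OF a(2) b(2) k a(4) b(4) _ _ gap])
      (use k eigengap_le_upper eigengap_le_lower in auto)
  ultimately show "sin (line_angle (v k) (w k)) \<le> 2 * sqrt 2 / eigengap N l k * frob N (\<lambda>x. B $$ x - A $$ x)"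
    unfolding eq using gap by (simp add: field_simps)
qed

text \<open>
  The spectral norm is dominated by the Frobenius norm, to which the perturbation bound applies. For
  \<open>r = N\<close> both projections are the identity; then no eigenvalue lies below the \<open>r\<close>-th one, and any gap
  may be used.
\<close>
lemma span_projection_diff_le:
  assumes A: "A \<in> carrier_mat N N" "ordered_eigensystem N A l v"
    and B: "B \<in> carrier_mat N N" "ordered_eigensystem N B l' w"
    and r: "1 \<le> r" "r \<le> N" and g: "0 < g" "g \<le> eigengap N l r"
  shows "spectral_norm (span_projection N r w - span_projection N r v)
    \<le> 2 / g * frob N (\<lambda>x. B $$ x - A $$ x)"
proof -
  note a = ordered_eigensystemD[OF A(2,1)] and b = ordered_eigensystemD[OF B(2,1)]
  let ?D = "span_projection N r w - span_projection N r v"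
  let ?v = "\<lambda>k i. v k $ i" and ?w = "\<lambda>k i. w k $ i"
  have "spectral_norm ?D \<le> frob N (entries ?D)"
    using r by (intro spectral_norm_le_frob) (auto simp: span_projection_def)
  also have "\<dots> = frob N (\<lambda>x. - (leading r ?v x - leading r ?w x))"
    by (intro frob_cong) (auto simp: span_projection_def spectral_def)
  also have "\<dots> = frob N (\<lambda>x. leading r ?v x - leading r ?w x)"
    by (rule L2_set_minus)
  finally have D: "spectral_norm ?D \<le> frob N (\<lambda>x. leading r ?v x - leading r ?w x)" .
  have E: "frob N (\<lambda>x. spectral {1..N} l' ?w x - spectral {1..N} l ?v x)
      = frob N (\<lambda>x. B $$ x - A $$ x)"
    by (rule frob_cong) (simp only: a(3) b(3))
  have hi: "l r \<le> l j" if "j \<in> {1..r}" for j using a(4)[of j r] that r by auto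
  have "g * frob N (\<lambda>x. leading r ?v x - leading r ?w x) \<le> 2 * frob N (\<lambda>x. B $$ x - A $$ x)"
  proof (cases "r < N")
    case True
    have "g \<le> l r - l (Suc r)" using eigengap_le_lower[of r N l] g r True by simp
    moreover have "l j \<le> l (Suc r)" if "j \<in> {Suc r..N}" for j using a(4)[of "Suc r" j] that by auto
    ultimately show ?thesis
      unfolding E[symmetric] using hi
      by (intro davis_kahan_leading[OF a(2) b(2) r(2) b(4), where a = "l r" and b = "l (Suc r)"])
  next
    case False
    then show ?thesis
      unfolding E[symmetric] using hi
      by (intro davis_kahan_leading[OF a(2) b(2) r(2) b(4), where a = "l r" and b = "l r - g"]) auto
  qed
  then have "frob N (\<lambda>x. leading r ?v x - leading r ?w x) \<le> 2 / g * frob N (\<lambda>x. B $$ x - A $$ x)"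
    using g by (simp add: field_simps)
  with D show ?thesis by (rule order_trans)
qed

section \<open>Error of the empirical projections\<close>

lemma outer_product_integrable:
  assumes "prob_space \<rho>" and u: "\<And>i. i < N \<Longrightarrow> (\<lambda>\<mu>. u \<mu> $ i) \<in> borel_measurable \<rho>"
    and bound: "AE \<mu> in \<rho>. frob N (\<lambda>x. u \<mu> $ fst x * u \<mu> $ snd x) \<le> R"
    and x: "x \<in> {..<N} \<times> {..<N}"
  shows "integrable \<rho> (\<lambda>\<mu>. u \<mu> $ fst x * u \<mu> $ snd x)"
proof -
  interpret prob_space \<rho> by fact
  show ?thesis
  proof (rule integrable_const_bound)
    have "\<bar>u \<mu> $ fst x * u \<mu> $ snd x\<bar> \<le> frob N (\<lambda>x. u \<mu> $ fst x * u \<mu> $ snd x)" for \<mu>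
      using member_le_L2_set[OF _ x, of "\<lambda>x. \<bar>u \<mu> $ fst x * u \<mu> $ snd x\<bar>"] by (simp add: L2_set_def)
    then show "AE \<mu> in \<rho>. norm (u \<mu> $ fst x * u \<mu> $ snd x) \<le> R"
      using bound by (auto elim!: eventually_mono intro: order_trans)
    show "(\<lambda>\<mu>. u \<mu> $ fst x * u \<mu> $ snd x) \<in> borel_measurable \<rho>"
      using x by (intro borel_measurable_times u) auto
  qed
qed

lemma frob_outer_product:
  "frob N (\<lambda>x. y (fst x) * y (snd x)) = (L2_set y {..<N})\<^sup>2"
proof -
  have "(\<Sum>x\<in>{..<N} \<times> {..<N}. (y (fst x) * y (snd x))\<^sup>2) = (\<Sum>i<N. (y i)\<^sup>2) * (\<Sum>i<N. (y i)\<^sup>2)"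
    by (simp add: sum_product sum.cartesian_product power_mult_distrib case_prod_unfold)
  then show ?thesis
    by (simp add: L2_set_def sum_nonneg)
qed

lemma (in prob_space) probability_of_dominated:
  fixes f g :: "'a \<Rightarrow> real"
  assumes f: "f \<in> borel_measurable M" and le: "\<And>\<omega>. \<omega> \<in> space M \<Longrightarrow> f \<omega> \<le> c * g \<omega>"
    and c: "0 \<le> c" and ct: "c * t \<le> b" and p: "p \<le> \<P>(\<omega> in M. g \<omega> < t)"
  shows "p \<le> \<P>(\<omega> in M. f \<omega> \<le> b)"
proof -
  have sub: "{\<omega> \<in> space M. g \<omega> < t} \<subseteq> {\<omega> \<in> space M. f \<omega> \<le> b}"
  proof safe
    fix \<omega> assume "\<omega> \<in> space M" "g \<omega> < t"
    then show "f \<omega> \<le> b"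
      using le[of \<omega>] ct mult_left_mono[of "g \<omega>" t c] c by linarith
  qed
  have "{\<omega> \<in> space M. f \<omega> \<le> b} \<in> sets M" using f by measurable
  from finite_measure_mono[OF sub this] p show ?thesis by linarith
qed

lemma expectation_of_dominated:
  fixes f g :: "'a \<Rightarrow> real"
  assumes "integrable M g" and "\<And>\<omega>. \<omega> \<in> space M \<Longrightarrow> f \<omega> \<le> c * g \<omega>"
    and "\<And>\<omega>. 0 \<le> g \<omega>" and "0 \<le> c" and "(\<integral>\<omega>. g \<omega> \<partial>M) \<le> e" and "c * e \<le> b"
  shows "(\<integral>\<omega>. f \<omega> \<partial>M) \<le> b"
proof -
  have "(\<integral>\<omega>. f \<omega> \<partial>M) \<le> (\<integral>\<omega>. c * g \<omega> \<partial>M)"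
    by (rule integral_mono') (use assms in auto)
  also have "\<dots> = c * (\<integral>\<omega>. g \<omega> \<partial>M)" by simp
  also have "\<dots> \<le> c * e" using assms by (intro mult_left_mono) auto
  also have "\<dots> \<le> b" by fact
  finally show ?thesis .
qed

text \<open>
  The perturbation bounds hold for every sample, so the events in question contain an event on the
  deviation \<open>dev\<close> alone. Measurability of the errors is still needed, since the measure of a
  nonmeasurable set is 0 by convention. The constant 4 is the product of \<open>2 * sqrt 2\<close> (perturbation), 2 (centring)
  and \<open>sqrt 2\<close> (tail), divided by the 2 in front of the constant in the claim.
\<close>
lemma projection_error_bounds:
  fixes \<rho> :: "'a measure" and u :: "'a \<Rightarrow> real vec" and n :: nat
  assumes \<rho>: "prob_space \<rho>"
    and u: "\<And>\<mu>. \<mu> \<in> space \<rho> \<Longrightarrow> u \<mu> \<in> carrier_vec N"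
    and meas: "\<And>i. i < N \<Longrightarrow> (\<lambda>\<mu>. u \<mu> $ i) \<in> borel_measurable \<rho>"
    and R: "0 < R" and bound: "AE \<mu> in \<rho>. (norm2 (u \<mu>))\<^sup>2 \<le> R"
    and r: "1 \<le> r" "r \<le> N"
    and sys: "ordered_eigensystem N (second_moment N \<rho> u) l v"
    and sys_n: "\<And>\<omega>. \<omega> \<in> space (iid n \<rho>) \<Longrightarrow>
      ordered_eigensystem N (sample_moment N u n \<omega>) (lh \<omega>) (vh \<omega>)"
    and meas_n: "\<And>k i. k \<in> {1..r} \<Longrightarrow> i < N \<Longrightarrow> (\<lambda>\<omega>. vh \<omega> k $ i) \<in> borel_measurable (iid n \<rho>)"
    and gap: "\<And>k. k \<in> {1..r} \<Longrightarrow> 0 < eigengap N l k"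
    and n: "1 \<le> n"
  defines "mingap \<equiv> Min (eigengap N l ` {1..r})"
  shows sin_angle_tail: "\<And>\<delta> k. 0 < \<delta> \<Longrightarrow> \<delta> < 1 \<Longrightarrow> k \<in> {1..r} \<Longrightarrow>
      1 - \<delta> \<le> \<P>(\<omega> in iid n \<rho>. sin (line_angle (v k) (vh \<omega> k))
        \<le> 2 * (4 * R) / eigengap N l k * sqrt (ln (2 * real N / \<delta>) / real n))"
    and projection_tail: "\<And>\<delta>. 0 < \<delta> \<Longrightarrow> \<delta> < 1 \<Longrightarrow>
      1 - \<delta> \<le> \<P>(\<omega> in iid n \<rho>. spectral_norm (span_projection N r (vh \<omega>) - span_projection N r v)
        \<le> 2 * sqrt (real r) * (4 * R) / mingap * sqrt (ln (2 * real N / \<delta>) / real n))"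
    and sin_angle_expectation: "\<And>k. k \<in> {1..r} \<Longrightarrow>
      (\<integral>\<omega>. sin (line_angle (v k) (vh \<omega> k)) \<partial>iid n \<rho>)
        \<le> 12 * R * (1 / (eigengap N l k * sqrt (real n)))"
    and projection_expectation:
      "(\<integral>\<omega>. spectral_norm (span_projection N r (vh \<omega>) - span_projection N r v) \<partial>iid n \<rho>)
        \<le> 12 * R * (sqrt (real r) / (mingap * sqrt (real n)))"
proof -
  interpret iid: prob_space "iid n \<rho>" by (rule prob_space_iid[OF \<rho>])
  let ?I = "{..<N} \<times> {..<N}" and ?A = "second_moment N \<rho> u" and ?B = "\<lambda>\<omega>. sample_moment N u n \<omega>"
  have A: "?A \<in> carrier_mat N N" and B: "?B \<omega> \<in> carrier_mat N N" for \<omega>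
    by (simp_all add: second_moment_def sample_moment_def)
  define Z where "Z = (\<lambda>x \<mu>. u \<mu> $ fst x * u \<mu> $ snd x)"
  have "AE \<mu> in \<rho>. (norm2 (u \<mu>))\<^sup>2 = frob N (\<lambda>x. Z x \<mu>)"
    using u by (intro AE_I2) (simp add: Z_def frob_outer_product norm2_L2_set[OF u])
  with bound have bZ: "AE \<mu> in \<rho>. frob N (\<lambda>x. Z x \<mu>) \<le> R" by eventually_elim simp
  have iZ: "integrable \<rho> (Z x)" if "x \<in> ?I" for x
    unfolding Z_def using outer_product_integrable[OF \<rho> meas bZ[unfolded Z_def] that] by simp
  define dev where "dev \<omega> = frob N (\<lambda>x. (\<Sum>s=1..n. Z x (\<omega> s)) / real n - (\<integral>\<mu>. Z x \<mu> \<partial>\<rho>))" for \<omega>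
  have tail: "1 - \<delta> \<le> \<P>(\<omega> in iid n \<rho>. dev \<omega> < 2 * R * sqrt (2 * ln (2 / \<delta>) / real n))"
    if "0 < \<delta>" "\<delta> < 1" for \<delta>
    unfolding dev_def by (rule sample_mean_tail[OF \<rho> iZ R bZ n that])
  have dev_int: "integrable (iid n \<rho>) dev"
    unfolding dev_def[abs_def] by (rule integrable_sample_mean_deviation[OF \<rho> iZ R bZ n])
  have dev_exp: "(\<integral>\<omega>. dev \<omega> \<partial>iid n \<rho>) \<le> 4 * R / sqrt (real n)"
    unfolding dev_def by (rule expectation_sample_mean_deviation[OF \<rho> iZ R bZ n])
  have dev0: "0 \<le> dev \<omega>" for \<omega> by (simp add: dev_def)
  have dev_eq: "frob N (\<lambda>x. ?B \<omega> $$ x - ?A $$ x) = dev \<omega>" for \<omega>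
    unfolding dev_def by (rule frob_cong) (auto simp: sample_moment_def second_moment_def Z_def)
  have mingap: "0 < mingap" "mingap \<le> eigengap N l r"
    unfolding mingap_def using r gap by auto
  let ?sin = "\<lambda>k \<omega>. sin (line_angle (v k) (vh \<omega> k))"
  let ?P = "\<lambda>\<omega>. spectral_norm (span_projection N r (vh \<omega>) - span_projection N r v)"
  have sin_le: "?sin k \<omega> \<le> 2 * sqrt 2 / eigengap N l k * dev \<omega>"
    if "k \<in> {1..r}" "\<omega> \<in> space (iid n \<rho>)" for k \<omega>
    using sin_line_angle_eigenvectors_le(2)[OF A sys B sys_n[OF that(2)] _ gap[OF that(1)]] that r
    by (simp add: dev_eq)
  have P_le: "?P \<omega> \<le> 2 / mingap * dev \<omega>" if "\<omega> \<in> space (iid n \<rho>)" for \<omega>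
    using span_projection_diff_le[OF A sys B sys_n[OF that] r mingap] by (simp add: dev_eq)
  have sin_meas: "?sin k \<in> borel_measurable (iid n \<rho>)" if k: "k \<in> {1..r}" for k
  proof -
    have "(\<lambda>\<omega>. dot {..<N} (\<lambda>i. v k $ i) (\<lambda>i. vh \<omega> k $ i)) \<in> borel_measurable (iid n \<rho>)"
      unfolding dot_def using meas_n[OF k] by (intro borel_measurable_sum borel_measurable_times) auto
    then have "(\<lambda>\<omega>. sqrt (1 - (dot {..<N} (\<lambda>i. v k $ i) (\<lambda>i. vh \<omega> k $ i))\<^sup>2)) \<in> borel_measurable (iid n \<rho>)"
      by measurable
    then show ?thesis
      by (rule measurable_cong[THEN iffD2, rotated])
        (use sin_line_angle_eigenvectors_le(1)[OF A sys B sys_n _ gap[OF k]] k r in auto)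
  qed
  have P_meas: "?P \<in> borel_measurable (iid n \<rho>)"
  proof (rule borel_measurable_spectral_norm)
    fix i j assume ij: "i < N" "j < N"
    have "(\<lambda>\<omega>. (\<Sum>k=1..r. vh \<omega> k $ i * vh \<omega> k $ j) - (\<Sum>k=1..r. v k $ i * v k $ j))
        \<in> borel_measurable (iid n \<rho>)"
      using ij by (intro borel_measurable_diff borel_measurable_sum borel_measurable_times meas_n) auto
    then show "(\<lambda>\<omega>. (span_projection N r (vh \<omega>) - span_projection N r v) $$ (i, j)) \<in> borel_measurable (iid n \<rho>)"
      using ij by (simp add: span_projection_def)
  qed (use r in \<open>auto simp: span_projection_def\<close>)
  have sqrt2: "sqrt 2 * sqrt 2 = (2::real)" by simp
  have sqrt_r: "1 \<le> sqrt (real r)" using r by simp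
  then have sqrt_2r: "sqrt 2 \<le> 2 * sqrt (real r)" using sqrt2_less_2 by linarith
  have level: "sqrt (2 * ln (2 / \<delta>) / real n) \<le> sqrt 2 * sqrt (ln (2 * real N / \<delta>) / real n)"
    if "0 < \<delta>" "\<delta> < 1" for \<delta>
  proof -
    have "2 / \<delta> \<le> 2 * real N / \<delta>" using that r by (intro divide_right_mono) auto
    then have "ln (2 / \<delta>) \<le> ln (2 * real N / \<delta>)" using that by (intro ln_mono) auto
    then have "sqrt (2 * ln (2 / \<delta>) / real n) \<le> sqrt (2 * (ln (2 * real N / \<delta>) / real n))"
      by (simp add: divide_right_mono)
    then show ?thesis by (simp only: real_sqrt_mult)
  qed
  show "1 - \<delta> \<le> \<P>(\<omega> in iid n \<rho>. ?sin k \<omega>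
        \<le> 2 * (4 * R) / eigengap N l k * sqrt (ln (2 * real N / \<delta>) / real n))"
    if \<delta>: "0 < \<delta>" "\<delta> < 1" and k: "k \<in> {1..r}" for \<delta> k
  proof (rule iid.probability_of_dominated[OF sin_meas[OF k] sin_le[OF k] _ _ tail[OF \<delta>]])
    let ?s = "sqrt (ln (2 * real N / \<delta>) / real n)"
    have "2 * sqrt 2 / eigengap N l k * (2 * R * sqrt (2 * ln (2 / \<delta>) / real n))
        \<le> 2 * sqrt 2 / eigengap N l k * (2 * R * (sqrt 2 * ?s))"
      using level[OF \<delta>] R gap[OF k] by (intro mult_left_mono) auto
    also have "\<dots> = (sqrt 2 * sqrt 2) * (4 * R / eigengap N l k * ?s)"
      by (simp add: divide_inverse mult_ac del: real_sqrt_mult_self)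
    also have "\<dots> = 2 * (4 * R) / eigengap N l k * ?s"
      unfolding sqrt2 by simp
    finally show "2 * sqrt 2 / eigengap N l k * (2 * R * sqrt (2 * ln (2 / \<delta>) / real n))
        \<le> 2 * (4 * R) / eigengap N l k * ?s" .
  qed (use gap[OF k] in auto)
  show "1 - \<delta> \<le> \<P>(\<omega> in iid n \<rho>. ?P \<omega>
        \<le> 2 * sqrt (real r) * (4 * R) / mingap * sqrt (ln (2 * real N / \<delta>) / real n))"
    if \<delta>: "0 < \<delta>" "\<delta> < 1" for \<delta>
  proof (rule iid.probability_of_dominated[OF P_meas P_le _ _ tail[OF \<delta>]])
    let ?s = "sqrt (ln (2 * real N / \<delta>) / real n)"
    have s0: "0 \<le> ?s" using \<delta> r by (intro real_sqrt_ge_zero divide_nonneg_nonneg ln_ge_zero) (auto simp: field_simps)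
    have "2 / mingap * (2 * R * sqrt (2 * ln (2 / \<delta>) / real n)) \<le> 2 / mingap * (2 * R * (sqrt 2 * ?s))"
      using level[OF \<delta>] R mingap by (intro mult_left_mono) auto
    also have "\<dots> \<le> 2 / mingap * (2 * R * ((2 * sqrt (real r)) * ?s))"
      using s0 R mingap sqrt_2r by (intro mult_left_mono mult_right_mono) auto
    also have "\<dots> = 2 * sqrt (real r) * (4 * R) / mingap * ?s"
      by (simp add: divide_inverse mult_ac)
    finally show "2 / mingap * (2 * R * sqrt (2 * ln (2 / \<delta>) / real n))
        \<le> 2 * sqrt (real r) * (4 * R) / mingap * ?s" .
  qed (use mingap in auto)
  show "(\<integral>\<omega>. ?sin k \<omega> \<partial>iid n \<rho>) \<le> 12 * R * (1 / (eigengap N l k * sqrt (real n)))"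
    if k: "k \<in> {1..r}" for k
  proof (rule expectation_of_dominated[OF dev_int sin_le[OF k] dev0 _ dev_exp])
    let ?x = "R / (eigengap N l k * sqrt (real n))"
    have "2 * sqrt 2 / eigengap N l k * (4 * R / sqrt (real n)) = sqrt 2 * (8 * ?x)" by simp
    \<comment> \<open>The constant \<open>8 * sqrt 2\<close> is rounded up to 12.\<close>
    also have "\<dots> \<le> 3 / 2 * (8 * ?x)"
    proof (rule mult_right_mono)
      show "sqrt 2 \<le> 3 / 2" by (rule real_le_lsqrt) (auto simp: power2_eq_square)
      show "0 \<le> 8 * ?x" using R gap[OF k] by simp
    qed
    also have "\<dots> = 12 * R * (1 / (eigengap N l k * sqrt (real n)))" by simp
    finally show "2 * sqrt 2 / eigengap N l k * (4 * R / sqrt (real n))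
        \<le> 12 * R * (1 / (eigengap N l k * sqrt (real n)))" .
  qed (use gap[OF k] in auto)
  show "(\<integral>\<omega>. ?P \<omega> \<partial>iid n \<rho>) \<le> 12 * R * (sqrt (real r) / (mingap * sqrt (real n)))"
  proof (rule expectation_of_dominated[OF dev_int P_le dev0 _ dev_exp])
    have "8 \<le> 12 * sqrt (real r)" using sqrt_r by linarith
    then have "8 * (R / (mingap * sqrt (real n))) \<le> (12 * sqrt (real r)) * (R / (mingap * sqrt (real n)))"
      using R mingap by (intro mult_right_mono) auto
    then show "2 / mingap * (4 * R / sqrt (real n)) \<le> 12 * R * (sqrt (real r) / (mingap * sqrt (real n)))"
      by (simp add: divide_inverse mult_ac)
  qed (use mingap in auto)
qed

theorem mainTheorem2:
  shows "\<exists>(C :: real \<Rightarrow> real \<Rightarrow> real) (K :: nat \<Rightarrow> real \<Rightarrow> real \<Rightarrow> real).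
    \<forall>(p :: nat) (N :: nat) (D :: (nat \<Rightarrow> real) set) (\<rho> :: (nat \<Rightarrow> real) measure)
      (u :: (nat \<Rightarrow> real) \<Rightarrow> real vec) (M :: real) (R :: real) (r :: nat)
      (l :: nat \<Rightarrow> real) (v :: nat \<Rightarrow> real vec)
      (lh :: nat \<Rightarrow> (nat \<Rightarrow> nat \<Rightarrow> real) \<Rightarrow> nat \<Rightarrow> real)
      (vh :: nat \<Rightarrow> (nat \<Rightarrow> nat \<Rightarrow> real) \<Rightarrow> nat \<Rightarrow> real vec).
      D \<subseteq> real_space p \<longrightarrow> compact D \<longrightarrow>
      prob_space \<rho> \<longrightarrow> sets \<rho> = sets (restrict_space borel D) \<longrightarrow>
      (\<forall>\<mu>\<in>D. u \<mu> \<in> carrier_vec N) \<longrightarrow>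
      (\<forall>i<N. (\<lambda>\<mu>. u \<mu> $ i) \<in> borel_measurable \<rho>) \<longrightarrow>
      0 < M \<longrightarrow> 0 < R \<longrightarrow>
      (\<integral>\<mu>. (norm2 (u \<mu>))\<^sup>2 \<partial>\<rho>) \<le> M\<^sup>2 \<longrightarrow>
      (AE \<mu> in \<rho>. (norm2 (u \<mu>))\<^sup>2 \<le> R) \<longrightarrow>
      1 \<le> r \<longrightarrow> r \<le> N \<longrightarrow>
      ordered_eigensystem N (second_moment N \<rho> u) l v \<longrightarrow>
      (\<forall>n\<ge>1. \<forall>\<omega>\<in>space (iid n \<rho>).
         ordered_eigensystem N (sample_moment N u n \<omega>) (lh n \<omega>) (vh n \<omega>)) \<longrightarrow>
      (\<forall>n\<ge>1. \<forall>k\<in>{1..r}. \<forall>i<N. (\<lambda>\<omega>. vh n \<omega> k $ i) \<in> borel_measurable (iid n \<rho>)) \<longrightarrow>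
      (\<forall>k\<in>{1..r}. 0 < eigengap N l k) \<longrightarrow>
      (let L = spectral_norm (second_moment N \<rho> u);
           gap = eigengap N l;
           mingap = Min (eigengap N l ` {1..r});
           P = span_projection N r v;
           Ph = (\<lambda>n \<omega>. span_projection N r (vh n \<omega>))
       in
        (\<forall>\<delta>. 0 < \<delta> \<longrightarrow> \<delta> < 1 \<longrightarrow>
          (\<forall>\<^sub>F n in sequentially.
            (\<forall>k\<in>{1..r}.
               \<P>(\<omega> in iid n \<rho>. sin (line_angle (v k) (vh n \<omega> k))
                   \<le> 2 * C R L / gap k * sqrt (ln (2 * real N / \<delta>) / real n)) \<ge> 1 - \<delta>) \<and>
            \<P>(\<omega> in iid n \<rho>. spectral_norm (Ph n \<omega> - P)
                \<le> 2 * sqrt (real r) * C R L / mingap * sqrt (ln (2 * real N / \<delta>) / real n))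
              \<ge> 1 - \<delta>)) \<and>
        (\<forall>\<^sub>F n in sequentially.
          (\<forall>k\<in>{1..r}.
             (\<integral>\<omega>. sin (line_angle (v k) (vh n \<omega> k)) \<partial>iid n \<rho>)
               \<le> K N R L * (1 / (gap k * sqrt (real n)))) \<and>
          (\<integral>\<omega>. spectral_norm (Ph n \<omega> - P) \<partial>iid n \<rho>)
            \<le> K N R L * (sqrt (real r) / (mingap * sqrt (real n)))))"
proof (intro exI[of _ "\<lambda>R L. 4 * R"] exI[of _ "\<lambda>N R L. 12 * R"] allI impI)
  fix p N :: nat and D :: "(nat \<Rightarrow> real) set" and \<rho> :: "(nat \<Rightarrow> real) measure"
    and u :: "(nat \<Rightarrow> real) \<Rightarrow> real vec" and M R :: real and r :: nat
    and l :: "nat \<Rightarrow> real" and v :: "nat \<Rightarrow> real vec"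
    and lh :: "nat \<Rightarrow> (nat \<Rightarrow> nat \<Rightarrow> real) \<Rightarrow> nat \<Rightarrow> real"
    and vh :: "nat \<Rightarrow> (nat \<Rightarrow> nat \<Rightarrow> real) \<Rightarrow> nat \<Rightarrow> real vec"
  assume \<rho>: "prob_space \<rho>" and sets: "sets \<rho> = sets (restrict_space borel D)"
    and u: "\<forall>\<mu>\<in>D. u \<mu> \<in> carrier_vec N"
    and meas: "\<forall>i<N. (\<lambda>\<mu>. u \<mu> $ i) \<in> borel_measurable \<rho>"
    and R: "0 < R" and bound: "AE \<mu> in \<rho>. (norm2 (u \<mu>))\<^sup>2 \<le> R"
    and r: "1 \<le> r" "r \<le> N"
    and sys: "ordered_eigensystem N (second_moment N \<rho> u) l v"
    and sys_n: "\<forall>n\<ge>1. \<forall>\<omega>\<in>space (iid n \<rho>).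
         ordered_eigensystem N (sample_moment N u n \<omega>) (lh n \<omega>) (vh n \<omega>)"
    and meas_n: "\<forall>n\<ge>1. \<forall>k\<in>{1..r}. \<forall>i<N. (\<lambda>\<omega>. vh n \<omega> k $ i) \<in> borel_measurable (iid n \<rho>)"
    and gap: "\<forall>k\<in>{1..r}. 0 < eigengap N l k"
  have space: "space \<rho> = D"
    using sets_eq_imp_space_eq[OF sets] by (simp add: space_restrict_space)
  have large: "\<forall>\<^sub>F n in sequentially. Q n" if "\<And>n. 1 \<le> n \<Longrightarrow> Q n" for Q :: "nat \<Rightarrow> bool"
    using that unfolding eventually_sequentially by blast
  have u': "u \<mu> \<in> carrier_vec N" if "\<mu> \<in> space \<rho>" for \<mu>
    using u that space by blast
  show "let L = spectral_norm (second_moment N \<rho> u);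
           gap = eigengap N l;
           mingap = Min (eigengap N l ` {1..r});
           P = span_projection N r v;
           Ph = (\<lambda>n \<omega>. span_projection N r (vh n \<omega>))
       in
        (\<forall>\<delta>. 0 < \<delta> \<longrightarrow> \<delta> < 1 \<longrightarrow>
          (\<forall>\<^sub>F n in sequentially.
            (\<forall>k\<in>{1..r}.
               \<P>(\<omega> in iid n \<rho>. sin (line_angle (v k) (vh n \<omega> k))
                   \<le> 2 * (4 * R) / gap k * sqrt (ln (2 * real N / \<delta>) / real n)) \<ge> 1 - \<delta>) \<and>
            \<P>(\<omega> in iid n \<rho>. spectral_norm (Ph n \<omega> - P)
                \<le> 2 * sqrt (real r) * (4 * R) / mingap * sqrt (ln (2 * real N / \<delta>) / real n))
              \<ge> 1 - \<delta>)) \<and>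
        (\<forall>\<^sub>F n in sequentially.
          (\<forall>k\<in>{1..r}.
             (\<integral>\<omega>. sin (line_angle (v k) (vh n \<omega> k)) \<partial>iid n \<rho>)
               \<le> 12 * R * (1 / (gap k * sqrt (real n)))) \<and>
          (\<integral>\<omega>. spectral_norm (Ph n \<omega> - P) \<partial>iid n \<rho>)
            \<le> 12 * R * (sqrt (real r) / (mingap * sqrt (real n))))"
    unfolding Let_def
  proof (intro conjI allI impI large ballI)
    fix n :: nat assume n: "1 \<le> n"
    have hyps: "\<And>i. i < N \<Longrightarrow> (\<lambda>\<mu>. u \<mu> $ i) \<in> borel_measurable \<rho>"
      "\<And>\<omega>. \<omega> \<in> space (iid n \<rho>) \<Longrightarrow>
         ordered_eigensystem N (sample_moment N u n \<omega>) (lh n \<omega>) (vh n \<omega>)"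
      "\<And>k i. k \<in> {1..r} \<Longrightarrow> i < N \<Longrightarrow> (\<lambda>\<omega>. vh n \<omega> k $ i) \<in> borel_measurable (iid n \<rho>)"
      "\<And>k. k \<in> {1..r} \<Longrightarrow> 0 < eigengap N l k"
      using meas sys_n meas_n gap n by blast+
    note bounds_n = projection_error_bounds[OF \<rho> u' hyps(1) R bound r sys hyps(2,3,4) n]
    show "(\<integral>\<omega>. spectral_norm (span_projection N r (vh n \<omega>) - span_projection N r v) \<partial>iid n \<rho>)
        \<le> 12 * R * (sqrt (real r) / (Min (eigengap N l ` {1..r}) * sqrt (real n)))"
      by (rule bounds_n(4))
    show "(\<integral>\<omega>. sin (line_angle (v k) (vh n \<omega> k)) \<partial>iid n \<rho>)
        \<le> 12 * R * (1 / (eigengap N l k * sqrt (real n)))" if "k \<in> {1..r}" for k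
      by (rule bounds_n(3)) (use that in auto)
    fix \<delta> :: real assume \<delta>: "0 < \<delta>" "\<delta> < 1"
    show "1 - \<delta> \<le> \<P>(\<omega> in iid n \<rho>. spectral_norm (span_projection N r (vh n \<omega>) - span_projection N r v)
        \<le> 2 * sqrt (real r) * (4 * R) / Min (eigengap N l ` {1..r}) * sqrt (ln (2 * real N / \<delta>) / real n))"
      by (rule bounds_n(2)) (use \<delta> in auto)
    show "1 - \<delta> \<le> \<P>(\<omega> in iid n \<rho>. sin (line_angle (v k) (vh n \<omega> k))
        \<le> 2 * (4 * R) / eigengap N l k * sqrt (ln (2 * real N / \<delta>) / real n))" if "k \<in> {1..r}" for k
      by (rule bounds_n(1)) (use \<delta> that in auto)
  qed
qed

end
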